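(* Let $\mathcal A$ be a $3$-dimensional non-unimodular Lie algebra with unimodular ideal $I_0$. Then on $\mathcal A^*$ there exists some generic linear Poisson pair that is non-flat if and only if the endomorphism $[u,\cdot]_{|I_0}$ of $I_0$, where $u\in\mathcal A\setminus I_0$, is not a multiple of the identity.
   Context: Lie algebras are over $\mathbb K=\mathbb R$ or $\mathbb C$. The unimodular ideal of $\mathcal A$ is $I_0=\{a\in\mathcal A: \mathrm{tr}[a,\cdot]=0\}$; $\mathcal A$ is unimodular if $I_0=\mathcal A$. If $\mathcal A$ is $3$-dimensional and non-unimodular, $I_0$ is a $2$-dimensional abelian ideal, and the endomorphism $[u,\cdot]_{|I_0}$, $u\notin I_0$, is determined by $\mathcal A$ up to a non-zero multiplicative constant. Linear Poisson pair on $\mathcal A^*$: a couple $(\Lambda,\Lambda_1)$ where $\Lambda$ is the Lie–Poisson structure of $\mathcal A^*$ ($\Lambda(a,b)=[a,b]$ for $a,b\in\mathcal A$ regarded as linear functions) and $\Lambda_1$ is the constant bi-vector given by some $\beta\in\Lambda^2\mathcal A^*$ with $d\beta=0$ (Chevalley–Eilenberg cocycle). In dimension $3$ it is generic at a point $p$ if $(s\Lambda+t\Lambda_1)(p)\ne0$ for all $(s,t)\in\mathbb C^2\setminus\{0\}$ (complexifying in the real case); it is flat at $p$ if in some local coordinates around $p$ (smooth if $\mathbb K=\mathbb R$, holomorphic if $\mathbb K=\mathbb C$) both bi-vectors have constant coefficients. The pair is generic if it is generic at some point, and flat if it is flat at every generic point. *)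

theory Defs
  imports "HOL-Analysis.Analysis"
begin

section \<open>Lie algebras\<close>

context vector_space
begin

text \<open>The value does not depend on the basis, so the library's arbitrary choice of one is used.
  Meaningful in finite dimension only.\<close>

definition endo_trace :: "('b \<Rightarrow> 'b) \<Rightarrow> 'a" where
  "endo_trace f = (let B = extend_basis {} in \<Sum>b\<in>B. representation B (f b) b)"

end

locale lie_algebra = vector_space scale
  for scale :: "'k::field \<Rightarrow> 'a::ab_group_add \<Rightarrow> 'a" +
  fixes bracket :: "'a \<Rightarrow> 'a \<Rightarrow> 'a"
  assumes linear_bracket_left: "Vector_Spaces.linear scale scale (\<lambda>a. bracket a b)"
    and linear_bracket_right: "Vector_Spaces.linear scale scale (bracket a)"
    and bracket_self: "bracket a a = 0"
    and jacobi: "bracket (bracket a b) c + bracket (bracket b c) a + bracket (bracket c a) b = 0"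
begin

definition unimodular_ideal :: "'a set" where
  "unimodular_ideal = {a. endo_trace (bracket a) = 0}"

definition unimodular :: bool where
  "unimodular \<longleftrightarrow> unimodular_ideal = UNIV"

end


section \<open>The ground field and regularity of coordinate changes\<close>

primrec Ck_on :: "nat \<Rightarrow> 'a::real_normed_vector set \<Rightarrow> ('a \<Rightarrow> 'b::real_normed_vector) \<Rightarrow> bool" where
  "Ck_on 0 U f \<longleftrightarrow> continuous_on U f"
| "Ck_on (Suc n) U f \<longleftrightarrow> (\<forall>x\<in>U. f differentiable (at x)) \<and>
     (\<forall>v. Ck_on n U (\<lambda>x. frechet_derivative f (at x) v))"

text \<open>A syntactic class, used at the types \<^typ>\<open>real\<close> and \<^typ>\<open>complex\<close> only: it selects the embedding into
  the complex numbers and the meaning of regular map (smooth or holomorphic) between open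
  subsets of three-dimensional coordinate space.\<close>

class ground_field = real_normed_field +
  fixes to_complex :: "'a \<Rightarrow> complex"
    and regular_on :: "('a ^ 3) set \<Rightarrow> ('a ^ 3 \<Rightarrow> 'a ^ 3) \<Rightarrow> bool"

instantiation real :: ground_field
begin

definition to_complex_real :: "real \<Rightarrow> complex" where
  "to_complex_real x = complex_of_real x"

definition regular_on_real :: "(real ^ 3) set \<Rightarrow> (real ^ 3 \<Rightarrow> real ^ 3) \<Rightarrow> bool" where
  "regular_on_real U F \<longleftrightarrow> (\<forall>n. Ck_on n U F)"

instance ..

end

instantiation complex :: ground_field
begin

definition to_complex_complex :: "complex \<Rightarrow> complex" where
  "to_complex_complex z = z"

definition regular_on_complex :: "(complex ^ 3) set \<Rightarrow> (complex ^ 3 \<Rightarrow> complex ^ 3) \<Rightarrow> bool" where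
  "regular_on_complex U F \<longleftrightarrow>
     (\<forall>z\<in>U. \<exists>F'. (F has_derivative F') (at z) \<and> (\<forall>c v. F' (c *s v) = c *s F' v))"

instance ..

end

definition local_coordinates :: "('k::ground_field ^ 3) set \<Rightarrow> ('k ^ 3 \<Rightarrow> 'k ^ 3) \<Rightarrow> bool" where
  "local_coordinates U F \<longleftrightarrow> open U \<and> open (F ` U) \<and> inj_on F U \<and>
     regular_on U F \<and> regular_on (F ` U) (inv_into U F)"

text \<open>A bi-vector field on coordinate space is given by its matrix \<open>P\<close> of coefficients
  \<open>P x $ i $ j = P(dx\<^sub>i, dx\<^sub>j)\<close>; the matrix below consists of the coefficients
  \<open>P(dF\<^sub>i, dF\<^sub>j)\<close> at \<open>x\<close> in the coordinates \<open>F\<close>.\<close>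

definition bivector_in_coordinates ::
    "('k::ground_field ^ 3 \<Rightarrow> 'k ^ 3) \<Rightarrow> ('k ^ 3 \<Rightarrow> 'k ^ 3 ^ 3) \<Rightarrow> 'k ^ 3 \<Rightarrow> 'k ^ 3 ^ 3" where
  "bivector_in_coordinates F P x =
     (let J = matrix (frechet_derivative F (at x)) in J ** P x ** transpose J)"


section \<open>Linear Poisson pairs\<close>

text \<open>The pair consists of the Lie--Poisson structure on the dual, whose value at a functional
  \<open>p\<close> is \<open>(a, b) \<mapsto> p [a, b]\<close>, and the constant bi-vector \<open>\<beta>\<close>. Covectors at any point of the
  dual are elements of the Lie algebra. The last assumption is \<open>d\<beta> = 0\<close>.\<close>

locale linear_poisson_pair = lie_algebra scale bracket
  for scale :: "'k::ground_field \<Rightarrow> 'a::ab_group_add \<Rightarrow> 'a" and bracket +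
  fixes \<beta> :: "'a \<Rightarrow> 'a \<Rightarrow> 'k"
  assumes linear_left: "Vector_Spaces.linear scale (*) (\<lambda>a. \<beta> a b)"
    and linear_right: "Vector_Spaces.linear scale (*) (\<beta> a)"
    and alternating: "\<beta> a a = 0"
    and cocycle: "\<beta> (bracket a b) c + \<beta> (bracket b c) a + \<beta> (bracket c a) b = 0"
begin

definition dual :: "('a \<Rightarrow> 'k) set" where
  "dual = {p. Vector_Spaces.linear scale (*) p}"

definition lie_poisson :: "('a \<Rightarrow> 'k) \<Rightarrow> 'a \<Rightarrow> 'a \<Rightarrow> 'k" where
  "lie_poisson p a b = p (bracket a b)"

definition constant_bivector :: "('a \<Rightarrow> 'k) \<Rightarrow> 'a \<Rightarrow> 'a \<Rightarrow> 'k" where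
  "constant_bivector p a b = \<beta> a b"

text \<open>A complexified bi-vector vanishes iff it vanishes on the uncomplexified covectors.\<close>

definition generic_at :: "('a \<Rightarrow> 'k) \<Rightarrow> bool" where
  "generic_at p \<longleftrightarrow> (\<forall>s t :: complex. (s, t) \<noteq> (0, 0) \<longrightarrow>
     (\<exists>a b. s * to_complex (lie_poisson p a b) + t * to_complex (constant_bivector p a b) \<noteq> 0))"

definition generic :: bool where
  "generic \<longleftrightarrow> (\<exists>p\<in>dual. generic_at p)"

definition frame :: "(3 \<Rightarrow> 'a) \<Rightarrow> bool" where
  "frame e \<longleftrightarrow> inj e \<and> independent (range e) \<and> span (range e) = UNIV"

text \<open>A frame \<open>e\<close> is a global system of linear coordinates \<open>p \<mapsto> (p (e i))\<^sub>i\<close> on the dual;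
  \<open>dual_point e\<close> is its inverse.\<close>

definition dual_point :: "(3 \<Rightarrow> 'a) \<Rightarrow> 'k ^ 3 \<Rightarrow> 'a \<Rightarrow> 'k" where
  "dual_point e x a = (\<Sum>i\<in>UNIV. representation (range e) a (e i) * x $ i)"

definition coefficients ::
    "(3 \<Rightarrow> 'a) \<Rightarrow> (('a \<Rightarrow> 'k) \<Rightarrow> 'a \<Rightarrow> 'a \<Rightarrow> 'k) \<Rightarrow> 'k ^ 3 \<Rightarrow> 'k ^ 3 ^ 3" where
  "coefficients e B x = (\<chi> i j. B (dual_point e x) (e i) (e j))"

text \<open>The linear coordinates only transport the manifold structure, so the choice of the frame
  is immaterial.\<close>

definition flat_at :: "('a \<Rightarrow> 'k) \<Rightarrow> bool" where
  "flat_at p \<longleftrightarrow> (\<exists>e U F C C\<^sub>1. frame e \<and> (\<chi> i. p (e i)) \<in> U \<and> local_coordinates U F \<and>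
     (\<forall>x\<in>U. bivector_in_coordinates F (coefficients e lie_poisson) x = C \<and>
             bivector_in_coordinates F (coefficients e constant_bivector) x = C\<^sub>1))"

definition flat :: bool where
  "flat \<longleftrightarrow> (\<forall>p\<in>dual. generic_at p \<longrightarrow> flat_at p)"

end

end

theory Submission
  imports Defs
begin

text \<open>Let \<open>u\<close> lie outside the unimodular ideal \<open>I\<^sub>0\<close>, let \<open>T = [u, \<cdot>]\<close> on \<open>I\<^sub>0\<close>, and let the height \<open>h\<close> be the linear
  functional with kernel \<open>I\<^sub>0\<close> and \<open>h u = 1\<close>. The ideal is abelian, so the whole bracket is
  \<open>[a, b] = h(a) [u, b] - h(b) [u, a]\<close> (\<open>bracket_eq\<close>). Hence the Lie--Poisson structure at \<open>p\<close> is the wedge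
  product of the constant direction \<open>h\<close> with the linear vector field \<open>X(p) = p \<circ> [u, \<cdot>]\<close>, and a cocycle is the
  wedge product of the same direction with a constant vector \<open>Y\<close>. A pair is thus a linear and a constant
  vector field in the plane dual to \<open>I\<^sub>0\<close>; it is generic where they are independent, and its
  flatness is the vanishing of the curvature of the web formed by the trajectories of the fields \<open>X + t Y\<close>.

  Take a basis \<open>f1, f2\<close> of \<open>I\<^sub>0\<close> in whose dual coordinates \<open>Y = \<partial>\<^sub>1\<close>. The curvature vanishes exactly if the
  component \<open>X\<^sub>2 = p(T f2)\<close> does not depend on \<open>x\<^sub>1\<close>, that is, if \<open>f2\<close> is an eigenvector of \<open>T\<close>. For scalar \<open>T\<close>
  this is automatic, and \<open>(x\<^sub>1 / x\<^sub>2, 1 / x\<^sub>2, x\<^sub>2 x\<^sub>3)\<close> are flat coordinates near every generic point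
  (\<open>flat_if_scalar\<close>). If \<open>T\<close> is not scalar, some \<open>f2\<close> is not an eigenvector; the cocycle
  belonging to this \<open>f2\<close> and \<open>f1 = T f2\<close> gives a pair that is not flat.

  Non-flatness is proved without differential forms. Flat coordinates supply functions \<open>g0\<close> and \<open>g1\<close> such
  that \<open>g0 + t g1\<close> is a Casimir function of the \<open>t\<close>-th member of the pencil. In the plane this determines
  their partial derivatives up to a common factor, and these are compatible only if the factor vanishes
  (\<open>planar_web_rigid\<close>); the trace of \<open>T\<close> being non-zero enters here. Then the cocycle itself would vanish
  (\<open>nonflat_cocycle_not_flat_at\<close>).\<close>

section \<open>Frames and traces\<close>

locale coordinate_frame = vector_space scale
  for scale :: "'k::field \<Rightarrow> 'a::ab_group_add \<Rightarrow> 'a" +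
  fixes e :: "'i::finite \<Rightarrow> 'a"
  assumes inj_frame: "inj e"
    and independent_frame: "independent (range e)"
    and span_frame: "span (range e) = UNIV"
begin

definition coord :: "'i \<Rightarrow> 'a \<Rightarrow> 'k" where
  "coord i a = representation (range e) a (e i)"

lemma coord_add: "coord i (a + b) = coord i a + coord i b"
  by (simp add: coord_def representation_add independent_frame span_frame)

lemma coord_scale: "coord i (scale c a) = c * coord i a"
  by (simp add: coord_def representation_scale independent_frame span_frame)

lemma linear_coord: "Vector_Spaces.linear scale (*) (coord i)"
  unfolding Vector_Spaces.linear_iff
  using coord_add coord_scale vector_space_axioms vector_space_over_itself.vector_space_axioms
  by blast

lemma coord_frame: "coord i (e j) = (if i = j then 1 else 0)"
  using inj_frame by (auto simp: coord_def representation_basis independent_frame inj_eq)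

lemma expand_in_frame: "(\<Sum>i\<in>UNIV. scale (coord i a) (e i)) = a"
  using sum_representation_eq[OF independent_frame, of a "range e"] inj_frame
  by (simp add: span_frame sum.reindex coord_def)

lemma linear_functional_expand:
  assumes "Vector_Spaces.linear scale (*) f"
  shows "f a = (\<Sum>i\<in>UNIV. coord i a * f (e i))"
proof -
  interpret f: Vector_Spaces.linear scale "(*)" f by fact
  have "f a = f (\<Sum>i\<in>UNIV. scale (coord i a) (e i))"
    by (simp add: expand_in_frame)
  also have "\<dots> = (\<Sum>i\<in>UNIV. coord i a * f (e i))"
    by (simp add: f.sum f.scale)
  finally show ?thesis .
qed

text \<open>The definition of the trace picks an arbitrary basis; expanding one basis in the other shows that
  any frame computes the same number. All further trace computations choose their own frame.\<close>

lemma endo_trace_eq_sum_coord: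
  assumes "Vector_Spaces.linear scale scale f"
  shows "endo_trace f = (\<Sum>i\<in>UNIV. coord i (f (e i)))"
proof -
  interpret f: Vector_Spaces.linear scale scale f by fact
  define B where "B = extend_basis {}"
  have indep: "independent B" and spans: "span B = UNIV"
    by (simp_all add: B_def independent_extend_basis independent_empty)
  have fin: "finite B"
    using independent_span_bound[of "range e" B] by (simp add: indep span_frame)
  have rep_f: "representation B (f b) d = (\<Sum>i\<in>UNIV. coord i b * representation B (f (e i)) d)" for b d
  proof -
    have "f b = (\<Sum>i\<in>UNIV. scale (coord i b) (f (e i)))"
      using f.sum[of "\<lambda>i. scale (coord i b) (e i)" UNIV] by (simp add: expand_in_frame f.scale)
    then show ?thesis
      by (simp add: representation_sum representation_scale indep spans)
  qed
  have "endo_trace f = (\<Sum>b\<in>B. \<Sum>i\<in>UNIV. coord i b * representation B (f (e i)) b)"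
    unfolding endo_trace_def Let_def B_def[symmetric] by (rule sum.cong[OF refl rep_f])
  also have "\<dots> = (\<Sum>i\<in>UNIV. \<Sum>b\<in>B. coord i (scale (representation B (f (e i)) b) b))"
    by (subst sum.swap) (simp add: coord_scale mult.commute)
  also have "\<dots> = (\<Sum>i\<in>UNIV. coord i (\<Sum>b\<in>B. scale (representation B (f (e i)) b) b))"
  proof -
    interpret c: Vector_Spaces.linear scale "(*)" "coord i" for i by (rule linear_coord)
    show ?thesis by (simp add: c.sum)
  qed
  also have "\<dots> = (\<Sum>i\<in>UNIV. coord i (f (e i)))"
    by (simp add: sum_representation_eq indep spans fin)
  finally show ?thesis .
qed

lemma endo_trace_add:
  assumes f: "Vector_Spaces.linear scale scale f" and g: "Vector_Spaces.linear scale scale g"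
  shows "endo_trace (\<lambda>a. f a + g a) = endo_trace f + endo_trace g"
proof -
  have "Vector_Spaces.linear scale scale (\<lambda>a. f a + g a)"
    using f g unfolding Vector_Spaces.linear_iff by (simp add: scale_right_distrib)
  then show ?thesis
    by (simp add: endo_trace_eq_sum_coord f g coord_add sum.distrib)
qed

lemma endo_trace_scale:
  assumes f: "Vector_Spaces.linear scale scale f"
  shows "endo_trace (\<lambda>a. scale c (f a)) = c * endo_trace f"
proof -
  have "Vector_Spaces.linear scale scale (\<lambda>a. scale c (f a))"
    using f unfolding Vector_Spaces.linear_iff by (simp add: scale_right_distrib mult.commute)
  then show ?thesis
    by (simp add: endo_trace_eq_sum_coord f coord_scale sum_distrib_left)
qed

lemma endo_trace_compose_commute:
  assumes f: "Vector_Spaces.linear scale scale f" and g: "Vector_Spaces.linear scale scale g"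
  shows "endo_trace (\<lambda>a. f (g a)) = endo_trace (\<lambda>a. g (f a))"
proof -
  have sum_form: "endo_trace (\<lambda>a. f (g a)) =
      (\<Sum>i\<in>UNIV. \<Sum>j\<in>UNIV. coord j (g (e i)) * coord i (f (e j)))"
    if f: "Vector_Spaces.linear scale scale f" and g: "Vector_Spaces.linear scale scale g" for f g
  proof -
    have fg: "Vector_Spaces.linear scale scale (\<lambda>a. f (g a))"
      using f g unfolding Vector_Spaces.linear_iff by simp
    have "Vector_Spaces.linear scale (*) (\<lambda>a. coord i (f a))" for i
      using f linear_coord[of i] unfolding Vector_Spaces.linear_iff by simp
    then show ?thesis
      unfolding endo_trace_eq_sum_coord[OF fg]
      by (intro sum.cong[OF refl] linear_functional_expand)
  qed
  show ?thesis
    unfolding sum_form[OF f g] sum_form[OF g f]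
    by (subst sum.swap) (simp add: mult.commute)
qed

end

section \<open>Non-unimodular Lie algebras of dimension three\<close>

text \<open>Only the element outside the unimodular ideal is recorded: its existence already makes the
  algebra non-unimodular.\<close>

locale nonunimodular_lie_algebra = lie_algebra scale bracket
  for scale :: "'k::field \<Rightarrow> 'a::ab_group_add \<Rightarrow> 'a" and bracket +
  fixes u :: 'a
  assumes dim_3: "dim (UNIV :: 'a set) = 3"
    and u_notin_ideal: "u \<notin> unimodular_ideal"
begin

lemma bracket_add_left: "bracket (a + b) c = bracket a c + bracket b c"
  and bracket_scale_left: "bracket (scale k a) c = scale k (bracket a c)"
  using linear_bracket_left[of c] by (simp_all add: Vector_Spaces.linear_iff)

lemma bracket_add_right: "bracket c (a + b) = bracket c a + bracket c b"
  and bracket_scale_right: "bracket c (scale k a) = scale k (bracket c a)"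
  using linear_bracket_right[of c] by (simp_all add: Vector_Spaces.linear_iff)

lemma bracket_diff_left: "bracket (a - b) c = bracket a c - bracket b c"
  and bracket_diff_right: "bracket c (a - b) = bracket c a - bracket c b"
  using bracket_add_left[of "a - b" b c] bracket_add_right[of c "a - b" b] by simp_all

lemmas bracket_linear = bracket_add_left bracket_add_right bracket_scale_left bracket_scale_right
  bracket_diff_left bracket_diff_right

lemma bracket_antisym: "bracket a b = - bracket b a"
proof -
  have "bracket (a + b) (a + b) = 0" by (rule bracket_self)
  then show ?thesis
    using bracket_self[of a] bracket_self[of b]
    by (simp only: bracket_add_left bracket_add_right eq_neg_iff_add_eq_0) (simp add: add.commute)
qed

text \<open>The Jacobi identity as a statement about commutators of adjoint maps, written with a scalar
  multiple so that the additivity and homogeneity of the trace apply to the right-hand side.\<close>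

lemma jacobi_ad: "bracket (bracket a b) c = bracket a (bracket b c) + scale (- 1) (bracket b (bracket a c))"
proof -
  have "bracket (bracket b c) a = - bracket a (bracket b c)"
    by (rule bracket_antisym)
  moreover have "bracket (bracket c a) b = bracket b (bracket a c)"
    using bracket_antisym[of "bracket c a" b] bracket_antisym[of c a]
      bracket_diff_right[of b 0 "bracket a c"] bracket_diff_right[of b 0 0] by simp
  ultimately have "bracket (bracket a b) c + - bracket a (bracket b c) + bracket b (bracket a c) = 0"
    using jacobi[of a b c] by simp
  then show ?thesis
    using eq_iff_diff_eq_0[of "bracket (bracket a b) c" "bracket a (bracket b c) - bracket b (bracket a c)"]
    by (simp add: algebra_simps)
qed

lemma frame_exists: "\<exists>e :: 3 \<Rightarrow> 'a. coordinate_frame scale e"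
proof -
  obtain B where B: "independent B" "UNIV \<subseteq> span B" "card B = 3"
    using basis_exists[of UNIV] dim_3 by metis
  then have "finite B" by (simp add: card_ge_0_finite)
  with B(3) obtain e :: "3 \<Rightarrow> 'a" where "bij_betw e UNIV B"
    using finite_same_card_bij[of "UNIV :: 3 set" B] by auto
  with B show ?thesis
    by (intro exI[of _ e] coordinate_frame.intro coordinate_frame_axioms.intro)
       (auto simp: bij_betw_def vector_space_axioms)
qed

definition ad_trace :: "'a \<Rightarrow> 'k" where
  "ad_trace a = endo_trace (bracket a)"

text \<open>The trace of an adjoint map vanishes on commutators, because \<^term>\<open>bracket (bracket a b)\<close> is the
  commutator of two endomorphisms. Hence all brackets lie in the unimodular ideal.\<close>

lemma ad_trace_add: "ad_trace (a + b) = ad_trace a + ad_trace b"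
  and ad_trace_scale: "ad_trace (scale k a) = k * ad_trace a"
  and ad_trace_bracket: "ad_trace (bracket a b) = 0"
proof -
  obtain e :: "3 \<Rightarrow> 'a" where "coordinate_frame scale e"
    using frame_exists by blast
  then interpret e: coordinate_frame scale e .
  have "bracket (a + b) = (\<lambda>c. bracket a c + bracket b c)"
    by (simp add: fun_eq_iff bracket_linear)
  then show "ad_trace (a + b) = ad_trace a + ad_trace b"
    by (simp add: ad_trace_def e.endo_trace_add linear_bracket_right)
  have "bracket (scale k a) = (\<lambda>c. scale k (bracket a c))"
    by (simp add: fun_eq_iff bracket_linear)
  then show "ad_trace (scale k a) = k * ad_trace a"
    by (simp add: ad_trace_def e.endo_trace_scale linear_bracket_right)
  have comp: "Vector_Spaces.linear scale scale (\<lambda>c. bracket a (bracket b c))" for a b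
    by (simp add: Vector_Spaces.linear_iff vector_space_axioms bracket_linear)
  have scaled: "Vector_Spaces.linear scale scale (\<lambda>c. scale (- 1) (bracket a (bracket b c)))" for a b
    using vector_space_axioms
    by (simp add: Vector_Spaces.linear_iff bracket_linear scale_minus_left)
  have "bracket (bracket a b) =
      (\<lambda>c. bracket a (bracket b c) + scale (- 1) (bracket b (bracket a c)))"
    by (rule ext) (rule jacobi_ad)
  then have "ad_trace (bracket a b) =
      endo_trace (\<lambda>c. bracket a (bracket b c)) + - 1 * endo_trace (\<lambda>c. bracket b (bracket a c))"
    unfolding ad_trace_def by (simp only: e.endo_trace_add[OF comp scaled] e.endo_trace_scale[OF comp])
  then show "ad_trace (bracket a b) = 0"
    using e.endo_trace_compose_commute[OF linear_bracket_right linear_bracket_right, of a b] by simp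
qed

lemma ideal_iff: "a \<in> unimodular_ideal \<longleftrightarrow> ad_trace a = 0"
  by (simp add: unimodular_ideal_def ad_trace_def)

lemma ad_trace_u: "ad_trace u \<noteq> 0"
  using u_notin_ideal by (simp add: ideal_iff)

text \<open>The linear functional with kernel the unimodular ideal, normalised at \<open>u\<close>; it measures how far an
  element sticks out of the ideal in the direction of \<open>u\<close>.\<close>

definition height :: "'a \<Rightarrow> 'k" where
  "height a = ad_trace a / ad_trace u"

lemma height_add: "height (a + b) = height a + height b"
  and height_scale: "height (scale k a) = k * height a"
  and height_bracket: "height (bracket a b) = 0"
  and height_u: "height u = 1"
  using ad_trace_u
  by (simp_all add: height_def ad_trace_add ad_trace_scale ad_trace_bracket add_divide_distrib)

lemma ideal_iff_height: "a \<in> unimodular_ideal \<longleftrightarrow> height a = 0"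
  using ad_trace_u by (simp add: ideal_iff height_def)

lemma subspace_ideal: "subspace unimodular_ideal"
proof (rule subspaceI)
  show "0 \<in> unimodular_ideal"
    using height_scale[of 0 u] by (simp add: ideal_iff_height)
qed (simp_all add: ideal_iff_height height_add height_scale)

lemma ideal_part_in_ideal: "a - scale (height a) u \<in> unimodular_ideal"
  using height_add[of "a - scale (height a) u" "scale (height a) u"]
  by (simp add: ideal_iff_height height_scale height_u)

lemma adapted_frame:
  assumes f1: "f1 \<in> unimodular_ideal" and f2: "f2 \<in> unimodular_ideal"
    and nz: "f2 \<noteq> 0" and ndep: "\<And>k. f1 \<noteq> scale k f2"
  shows "coordinate_frame scale (($) (vector [f1, f2, u] :: 'a ^ 3))"
proof -
  have range: "range (($) (vector [f1, f2, u] :: 'a ^ 3)) = {u, f1, f2}"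
    by (auto simp: UNIV_3 vector_3)
  have "span {f1, f2} \<subseteq> unimodular_ideal"
    using f1 f2 by (intro span_minimal subspace_ideal) auto
  then have "u \<notin> span {f1, f2}"
    using u_notin_ideal by blast
  moreover have "f1 \<notin> span {f2}"
    using ndep by (auto simp: span_singleton)
  moreover have "f1 \<noteq> f2" using ndep[of 1] by auto
  moreover have "u \<noteq> f1" "u \<noteq> f2"
    using f1 f2 u_notin_ideal by auto
  ultimately have indep: "independent {u, f1, f2}" and card: "card {u, f1, f2} = 3"
    using nz by (auto simp: independent_insert)
  obtain B where B: "independent B" "UNIV \<subseteq> span B" "card B = 3"
    using basis_exists[of UNIV] dim_3 by metis
  then interpret fin: finite_dimensional_vector_space scale B
    by unfold_locales (auto simp: card_ge_0_finite)
  have "span {u, f1, f2} = UNIV"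
    using fin.card_ge_dim_independent[OF subset_UNIV indep] card dim_3 by auto
  moreover have "inj (($) (vector [f1, f2, u] :: 'a ^ 3))"
  proof (rule injI)
    fix i j :: 3
    assume "(vector [f1, f2, u] :: 'a ^ 3) $ i = vector [f1, f2, u] $ j"
    then show "i = j"
      using exhaust_3[of i] exhaust_3[of j] \<open>f1 \<noteq> f2\<close> \<open>u \<noteq> f1\<close> \<open>u \<noteq> f2\<close> by (auto simp: vector_3)
  qed
  ultimately show ?thesis
    using indep by unfold_locales (simp_all add: range)
qed

text \<open>A basis of the unimodular ideal, completed by \<open>u\<close>, spans the whole algebra, as every element is the
  sum of its height times \<open>u\<close> and an element of the ideal. So such a basis has exactly two elements.\<close>

lemma ideal_independent_pair:
  obtains g1 g2 where "g1 \<in> unimodular_ideal" "g2 \<in> unimodular_ideal" "g2 \<noteq> 0"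
    "\<And>k. g1 \<noteq> scale k g2"
proof -
  obtain B where B: "B \<subseteq> unimodular_ideal" "independent B" "unimodular_ideal \<subseteq> span B"
    using maximal_independent_subset by metis
  have "span B = unimodular_ideal"
    using B subspace_ideal span_minimal by blast
  have "a \<in> span (insert u B)" for a
  proof -
    have "a - scale (height a) u \<in> span B"
      using ideal_part_in_ideal B by blast
    then show ?thesis by (auto simp: span_insert)
  qed
  then have spans: "span (insert u B) = UNIV" by auto
  have "u \<notin> span B" using u_notin_ideal \<open>span B = unimodular_ideal\<close> by simp
  then have "independent (insert u B)" "u \<notin> B"
    using B(2) by (auto simp: independent_insert span_base)
  then have "card (insert u B) = 3"
    using dim_eq_card[of "insert u B" UNIV] dim_3 spans by simp
  then have "card B = 2"
    using \<open>u \<notin> B\<close> card_insert_disjoint[of B u] card.infinite[of "insert u B"] by (cases "finite B") auto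
  then obtain g1 g2 where "B = {g1, g2}" "g1 \<noteq> g2" by (meson card_2_iff)
  then have "g1 \<notin> span {g2}" "g2 \<noteq> 0" using B(2) by (auto simp: independent_insert dependent_zero)
  with that[of g1 g2] B(1) \<open>B = {g1, g2}\<close> show thesis
    by (auto simp: span_singleton)
qed

lemma adapted_coord:
  assumes f1: "f1 \<in> unimodular_ideal" and f2: "f2 \<in> unimodular_ideal"
    and frame: "coordinate_frame scale (($) (vector [f1, f2, u] :: 'a ^ 3))"
  defines "\<xi> \<equiv> coordinate_frame.coord scale (($) (vector [f1, f2, u] :: 'a ^ 3))"
  shows "\<xi> 3 a = height a"
    and "scale (\<xi> 1 a) f1 + scale (\<xi> 2 a) f2 + scale (height a) u = a"
proof -
  interpret f: coordinate_frame scale "($) (vector [f1, f2, u] :: 'a ^ 3)" by fact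
  have expand: "scale (\<xi> 1 a) f1 + scale (\<xi> 2 a) f2 + scale (\<xi> 3 a) u = a"
    using f.expand_in_frame[of a] by (simp add: \<xi>_def sum_3 vector_3)
  show "\<xi> 3 a = height a"
    using f1 f2 arg_cong[OF expand, of height]
    by (simp add: height_add height_scale height_u ideal_iff_height)
  with expand show "scale (\<xi> 1 a) f1 + scale (\<xi> 2 a) f2 + scale (height a) u = a" by simp
qed

lemma ad_trace_adapted:
  assumes f1: "f1 \<in> unimodular_ideal" and f2: "f2 \<in> unimodular_ideal"
    and frame: "coordinate_frame scale (($) (vector [f1, f2, u] :: 'a ^ 3))"
  defines "\<xi> \<equiv> coordinate_frame.coord scale (($) (vector [f1, f2, u] :: 'a ^ 3))"
  shows "ad_trace a = \<xi> 1 (bracket a f1) + \<xi> 2 (bracket a f2)"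
proof -
  interpret f: coordinate_frame scale "($) (vector [f1, f2, u] :: 'a ^ 3)" by fact
  show ?thesis
    using adapted_coord(1)[OF f1 f2 frame]
    by (simp add: \<xi>_def ad_trace_def f.endo_trace_eq_sum_coord linear_bracket_right sum_3
        vector_3 height_bracket)
qed

text \<open>For a basis \<open>g1, g2\<close> of the ideal write \<open>[g1, g2]\<close> in that basis. Brackets have height zero and
  \<open>[g1, g1] = 0\<close>, so the only diagonal entry of the adjoint map of \<open>g1\<close> is the \<open>g2\<close>-coordinate of
  \<open>[g1, g2]\<close>; it vanishes since the trace of that map does. The adjoint map of \<open>g2\<close> takes care of the
  other coordinate.\<close>

lemma ideal_abelian:
  assumes a: "a \<in> unimodular_ideal" and b: "b \<in> unimodular_ideal"
  shows "bracket a b = 0"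
proof -
  obtain g1 g2 where g: "g1 \<in> unimodular_ideal" "g2 \<in> unimodular_ideal" "g2 \<noteq> 0"
    "\<And>k. g1 \<noteq> scale k g2" using ideal_independent_pair by metis
  have frame: "coordinate_frame scale (($) (vector [g1, g2, u] :: 'a ^ 3))"
    by (rule adapted_frame) (use g in auto)
  interpret g: coordinate_frame scale "($) (vector [g1, g2, u] :: 'a ^ 3)" by fact
  note coord = adapted_coord[OF g(1,2) frame]
  note trace = ad_trace_adapted[OF g(1,2) frame]
  have zero: "g.coord i 0 = 0" for i using g.coord_scale[of i 0 0] by simp
  have "g.coord 2 (bracket g1 g2) = 0"
    using trace[of g1] g(1) by (simp add: ideal_iff bracket_self zero)
  moreover have "g.coord 1 (bracket g2 g1) = 0"
    using trace[of g2] g(2) by (simp add: ideal_iff bracket_self zero)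
  then have "g.coord 1 (bracket g1 g2) = 0"
    using g.coord_scale[of 1 "- 1" "bracket g2 g1"] bracket_antisym[of g1 g2]
    by (simp add: scale_minus_left)
  ultimately have 12: "bracket g1 g2 = 0"
    using coord(2)[of "bracket g1 g2"] by (simp add: height_bracket)
  then have 21: "bracket g2 g1 = 0" using bracket_antisym[of g2 g1] by simp
  have "a = scale (g.coord 1 a) g1 + scale (g.coord 2 a) g2"
    "b = scale (g.coord 1 b) g1 + scale (g.coord 2 b) g2"
    using coord(2)[of a, symmetric] coord(2)[of b, symmetric] a b by (simp_all add: ideal_iff_height)
  then have "bracket a b = bracket (scale (g.coord 1 a) g1 + scale (g.coord 2 a) g2)
      (scale (g.coord 1 b) g1 + scale (g.coord 2 b) g2)" by simp
  also have "\<dots> = 0"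
    by (simp add: bracket_linear bracket_self 12 21)
  finally show ?thesis .
qed

text \<open>The structure of the algebra in one formula: the bracket is the wedge product of the height with
  the adjoint map of \<open>u\<close>. It holds because the ideal parts of \<open>a\<close> and \<open>b\<close> commute.\<close>

lemma bracket_eq:
  "bracket a b = scale (height a) (bracket u b) - scale (height b) (bracket u a)"
proof -
  have "bracket (a - scale (height a) u) (b - scale (height b) u) = 0"
    by (intro ideal_abelian ideal_part_in_ideal)
  then have "bracket a b - scale (height b) (bracket a u) - scale (height a) (bracket u b) = 0"
    by (simp add: bracket_linear bracket_self algebra_simps)
  moreover have "scale (height b) (bracket a u) = - scale (height b) (bracket u a)"
    using bracket_antisym[of a u] by (simp add: scale_minus_right)
  ultimately show ?thesis
    using eq_iff_diff_eq_0[of "bracket a b"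
        "scale (height a) (bracket u b) - scale (height b) (bracket u a)"]
    by (simp add: algebra_simps)
qed

text \<open>An endomorphism of the ideal with every vector as an eigenvector is scalar: comparing the
  eigenvalues of \<open>g1\<close>, \<open>g2\<close> and \<open>g1 + g2\<close> for a basis \<open>g1, g2\<close> shows that they agree.\<close>

lemma nonscalar_vector:
  assumes "\<not> (\<exists>c. \<forall>a\<in>unimodular_ideal. bracket u a = scale c a)"
  obtains a where "a \<in> unimodular_ideal" "\<And>k. bracket u a \<noteq> scale k a"
proof -
  have False if eigen: "\<And>a. a \<in> unimodular_ideal \<Longrightarrow> \<exists>k. bracket u a = scale k a"
  proof -
    obtain g1 g2 where g: "g1 \<in> unimodular_ideal" "g2 \<in> unimodular_ideal" "g2 \<noteq> 0"
      "\<And>k. g1 \<noteq> scale k g2" using ideal_independent_pair by metis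
    have frame: "coordinate_frame scale (($) (vector [g1, g2, u] :: 'a ^ 3))"
      by (rule adapted_frame) (use g in auto)
    interpret g: coordinate_frame scale "($) (vector [g1, g2, u] :: 'a ^ 3)" by fact
    note coord = adapted_coord[OF g(1,2) frame]
    obtain k1 k2 k where k: "bracket u g1 = scale k1 g1" "bracket u g2 = scale k2 g2"
      "bracket u (g1 + g2) = scale k (g1 + g2)"
      using eigen g(1,2) subspace_add[OF subspace_ideal g(1,2)] by metis
    have basis: "g.coord 1 g1 = 1" "g.coord 1 g2 = 0" "g.coord 2 g1 = 0" "g.coord 2 g2 = 1"
      using g.coord_frame[of 1 1] g.coord_frame[of 1 2] g.coord_frame[of 2 1] g.coord_frame[of 2 2]
      by (simp_all add: vector_3)
    have eq: "scale k1 g1 + scale k2 g2 = scale k (g1 + g2)"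
      using k by (simp add: bracket_linear)
    have "k1 = k" "k2 = k"
      using arg_cong[OF eq, of "g.coord 1"] arg_cong[OF eq, of "g.coord 2"]
      by (simp_all add: g.coord_add g.coord_scale basis)
    have "bracket u a = scale k a" if "a \<in> unimodular_ideal" for a
    proof -
      have a: "a = scale (g.coord 1 a) g1 + scale (g.coord 2 a) g2"
        using coord(2)[of a, symmetric] that by (simp add: ideal_iff_height)
      have "bracket u (scale (g.coord 1 a) g1 + scale (g.coord 2 a) g2) =
          scale k (scale (g.coord 1 a) g1 + scale (g.coord 2 a) g2)"
        by (simp add: bracket_linear k(1,2) \<open>k1 = k\<close> \<open>k2 = k\<close> scale_right_distrib mult.commute)
      with a show ?thesis by simp
    qed
    with assms show False by blast
  qed
  with that show thesis by blast
qed

end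

section \<open>Rational maps are regular\<close>

lemma bounded_linear_axis:
  "bounded_linear (axis i :: 'b::real_normed_vector \<Rightarrow> 'b ^ 'n::finite)"
proof (rule bounded_linear_intro[where K = 1])
  show "norm (axis i x :: 'b ^ 'n) \<le> norm x * 1" for x :: 'b
  proof -
    have "norm (axis i x :: 'b ^ 'n) \<le> (\<Sum>j\<in>UNIV. norm ((axis i x :: 'b ^ 'n) $ j))"
      unfolding norm_vec_def by (rule L2_set_le_sum) simp
    also have "\<dots> = norm x"
      by (simp add: axis_def if_distrib cong: if_cong)
    finally show ?thesis by simp
  qed
qed (simp_all add: vec_eq_iff axis_def)

lemma has_derivative_vec:
  fixes F :: "'a::real_normed_vector \<Rightarrow> 'b::real_normed_vector ^ 'n::finite"
  assumes "\<And>i. ((\<lambda>x. F x $ i) has_derivative (\<lambda>v. D v $ i)) (at x within S)"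
  shows "(F has_derivative D) (at x within S)"
proof -
  have sum_axis: "(\<Sum>i\<in>UNIV. axis i (y $ i)) = y" for y :: "'b ^ 'n"
    by (simp add: vec_eq_iff axis_def if_distrib cong: if_cong)
  have "((\<lambda>x. \<Sum>i\<in>UNIV. axis i (F x $ i)) has_derivative (\<lambda>v. \<Sum>i\<in>UNIV. axis i (D v $ i)))
      (at x within S)"
    by (intro has_derivative_sum bounded_linear.has_derivative[OF bounded_linear_axis] assms)
  then show ?thesis by (simp add: sum_axis)
qed

text \<open>Rational functions without poles are the class of regular functions in which the flattening chart
  lives. The class is closed under directional derivatives, which yields smoothness and holomorphy by
  one argument.\<close>

inductive rational_on :: "('k::field ^ 'n) set \<Rightarrow> ('k ^ 'n \<Rightarrow> 'k) \<Rightarrow> bool" for U where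
  const: "rational_on U (\<lambda>x. c)"
| component: "rational_on U (\<lambda>x. x $ i)"
| add: "rational_on U f \<Longrightarrow> rational_on U g \<Longrightarrow> rational_on U (\<lambda>x. f x + g x)"
| mult: "rational_on U f \<Longrightarrow> rational_on U g \<Longrightarrow> rational_on U (\<lambda>x. f x * g x)"
| inverse: "rational_on U f \<Longrightarrow> (\<And>x. x \<in> U \<Longrightarrow> f x \<noteq> 0) \<Longrightarrow> rational_on U (\<lambda>x. inverse (f x))"

lemma rational_on_has_derivative:
  fixes f :: "'k::real_normed_field ^ 'n::finite \<Rightarrow> 'k"
  assumes "rational_on U f"
  shows "\<exists>D. (\<forall>v. rational_on U (\<lambda>x. D x v)) \<and>
    (\<forall>x\<in>U. (f has_derivative D x) (at x) \<and> (\<forall>c v. D x (c *s v) = c * D x v))"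
  using assms
proof induction
  case (const c)
  show ?case
    by (intro exI[of _ "\<lambda>x v. 0"]) (auto intro: rational_on.const)
next
  case (component i)
  show ?case
    by (intro exI[of _ "\<lambda>x v. v $ i"])
       (auto intro!: rational_on.const bounded_linear_imp_has_derivative)
next
  case (add f g)
  then obtain D E where
    "\<forall>v. rational_on U (\<lambda>x. D x v)" "\<forall>x\<in>U. (f has_derivative D x) (at x) \<and> (\<forall>c v. D x (c *s v) = c * D x v)"
    "\<forall>v. rational_on U (\<lambda>x. E x v)" "\<forall>x\<in>U. (g has_derivative E x) (at x) \<and> (\<forall>c v. E x (c *s v) = c * E x v)"
    by blast
  then show ?case
    by (intro exI[of _ "\<lambda>x v. D x v + E x v"])
       (auto intro!: rational_on.add has_derivative_add simp: distrib_left)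
next
  case (mult f g)
  then obtain D E where
    "\<forall>v. rational_on U (\<lambda>x. D x v)" "\<forall>x\<in>U. (f has_derivative D x) (at x) \<and> (\<forall>c v. D x (c *s v) = c * D x v)"
    "\<forall>v. rational_on U (\<lambda>x. E x v)" "\<forall>x\<in>U. (g has_derivative E x) (at x) \<and> (\<forall>c v. E x (c *s v) = c * E x v)"
    by blast
  with mult.hyps show ?case
    by (intro exI[of _ "\<lambda>x v. f x * E x v + D x v * g x"])
       (auto intro!: rational_on.add rational_on.mult has_derivative_mult
          simp: distrib_left mult.left_commute mult.assoc)
next
  case (inverse f)
  then obtain D where
    "\<forall>v. rational_on U (\<lambda>x. D x v)" "\<forall>x\<in>U. (f has_derivative D x) (at x) \<and> (\<forall>c v. D x (c *s v) = c * D x v)"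
    by blast
  moreover have "rational_on U (\<lambda>x. - 1 * (inverse (f x) * D x v * inverse (f x)))" for v
    using inverse calculation by (intro rational_on.intros) auto
  ultimately show ?case
    using inverse.hyps
    by (intro exI[of _ "\<lambda>x v. - (inverse (f x) * D x v * inverse (f x))"])
       (auto intro!: has_derivative_inverse)
qed

lemma rational_map_has_derivative:
  fixes F :: "'k::real_normed_field ^ 'n::finite \<Rightarrow> 'k ^ 'm::finite"
  assumes "\<And>i. rational_on U (\<lambda>x. F x $ i)"
  shows "\<exists>D. (\<forall>v i. rational_on U (\<lambda>x. D x v $ i)) \<and>
    (\<forall>x\<in>U. (F has_derivative D x) (at x) \<and> (\<forall>c v. D x (c *s v) = c *s D x v))"
proof -
  have "\<forall>i. \<exists>D. (\<forall>v. rational_on U (\<lambda>x. D x v)) \<and> (\<forall>x\<in>U. ((\<lambda>x. F x $ i) has_derivative D x) (at x) \<and>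
      (\<forall>c v. D x (c *s v) = c * D x v))"
    using rational_on_has_derivative[OF assms] by blast
  then obtain D where D: "\<And>i v. rational_on U (\<lambda>x. D i x v)"
    "\<And>i x. x \<in> U \<Longrightarrow> ((\<lambda>x. F x $ i) has_derivative D i x) (at x)"
    "\<And>i x c v. x \<in> U \<Longrightarrow> D i x (c *s v) = c * D i x v"
    by metis
  then show ?thesis
    by (intro exI[of _ "\<lambda>x v. \<chi> i. D i x v"]) (auto intro!: has_derivative_vec simp: vec_eq_iff)
qed

text \<open>What the two ground fields have in common, so that the real and the complex statement have the same
  proof: regular maps have derivatives linear over the field, rational maps are regular, and the
  embedding into the complex numbers respects products. A locale is used rather than a type class,
  because the assumptions speak about the normed space of triples over the field.\<close>

locale coordinate_field =
  fixes ground :: "'k::ground_field itself"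
  assumes regular_on_differentiable:
      "\<And>(U :: ('k ^ 3) set) F. regular_on U F \<Longrightarrow> x \<in> U \<Longrightarrow>
        \<exists>F'. (F has_derivative F') (at x) \<and> (\<forall>c v. F' (c *s v) = c *s F' v)"
    and rational_regular_on:
      "\<And>(U :: ('k ^ 3) set) F G. open U \<Longrightarrow> (\<And>i. rational_on U (\<lambda>x. G x $ i)) \<Longrightarrow>
        (\<And>x. x \<in> U \<Longrightarrow> F x = G x) \<Longrightarrow> regular_on U F"
    and to_complex_zero: "to_complex (0 :: 'k) = 0"
    and to_complex_one: "to_complex (1 :: 'k) = 1"
    and to_complex_mult: "\<And>a b :: 'k. to_complex (a * b) = to_complex a * to_complex b"

text \<open>A function that agrees with a rational one on an open set has there directional derivatives that
  again agree with rational functions, so the induction on the order of differentiability goes through.\<close>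

lemma rational_Ck_on:
  fixes F G :: "real ^ 'n::finite \<Rightarrow> real ^ 'm::finite"
  assumes "open U" "\<And>i. rational_on U (\<lambda>x. G x $ i)" "\<And>x. x \<in> U \<Longrightarrow> F x = G x"
  shows "Ck_on n U F"
  using assms(2,3)
proof (induction n arbitrary: F G)
  case (0 F G)
  from rational_map_has_derivative[OF 0(1)]
  have "\<exists>D. (G has_derivative D) (at x)" if "x \<in> U" for x using that by blast
  then have "continuous_on U G"
    by (intro continuous_at_imp_continuous_on ballI) (meson has_derivative_continuous)
  then show ?case using 0(2) by (simp cong: continuous_on_cong)
next
  case (Suc n F G)
  obtain D where D: "\<And>v i. rational_on U (\<lambda>x. D x v $ i)" "\<And>x. x \<in> U \<Longrightarrow> (G has_derivative D x) (at x)"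
    using rational_map_has_derivative[OF Suc.prems(1)] by blast
  have der: "(F has_derivative D x) (at x)" if "x \<in> U" for x
    using has_derivative_transform_within_open[OF D(2)[OF that] \<open>open U\<close> that] Suc.prems(2) by simp
  then have "frechet_derivative F (at x) = D x" if "x \<in> U" for x
    using frechet_derivative_at[OF der[OF that]] by simp
  then have "Ck_on n U (\<lambda>x. frechet_derivative F (at x) v)" for v
    by (intro Suc.IH[of "\<lambda>x. D x v"] D(1)) simp
  with der show ?case by (auto simp: differentiable_def)
qed

interpretation real: coordinate_field "TYPE(real)"
proof
  fix U :: "(real ^ 3) set" and F G :: "real ^ 3 \<Rightarrow> real ^ 3" and x
  show "\<exists>F'. (F has_derivative F') (at x) \<and> (\<forall>c v. F' (c *s v) = c *s F' v)"
    if "regular_on U F" "x \<in> U"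
  proof -
    have "Ck_on (Suc 0) U F" using that by (simp add: regular_on_real_def del: Ck_on.simps)
    with that obtain F' where "(F has_derivative F') (at x)" by (auto simp: differentiable_def)
    then show ?thesis
      using linear_scale[OF has_derivative_linear[of F F']]
      by (intro exI[of _ F']) (simp add: scalar_mult_eq_scaleR)
  qed
  show "regular_on U F"
    if "open U" "\<And>i. rational_on U (\<lambda>x. G x $ i)" "\<And>x. x \<in> U \<Longrightarrow> F x = G x"
    using rational_Ck_on[OF that] by (simp add: regular_on_real_def)
qed (simp_all add: to_complex_real_def)

interpretation complex: coordinate_field "TYPE(complex)"
proof
  fix U :: "(complex ^ 3) set" and F G :: "complex ^ 3 \<Rightarrow> complex ^ 3" and x
  show "\<exists>F'. (F has_derivative F') (at x) \<and> (\<forall>c v. F' (c *s v) = c *s F' v)"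
    if "regular_on U F" "x \<in> U"
    using that by (simp add: regular_on_complex_def)
  show "regular_on U F"
    if "open U" and rational: "\<And>i. rational_on U (\<lambda>x. G x $ i)" and eq: "\<And>x. x \<in> U \<Longrightarrow> F x = G x"
  proof -
    obtain D where D: "\<And>x. x \<in> U \<Longrightarrow> (G has_derivative D x) (at x)"
      "\<And>x c v. x \<in> U \<Longrightarrow> D x (c *s v) = c *s D x v"
      using rational_map_has_derivative[OF rational] by blast
    have "(F has_derivative D z) (at z)" if "z \<in> U" for z
      using has_derivative_transform_within_open[OF D(1)[OF that] \<open>open U\<close> that]
        eq by simp
    with D(2) show ?thesis unfolding regular_on_complex_def by blast
  qed
qed (simp_all add: to_complex_complex_def)

section \<open>Decomposable bi-vectors and the flattening chart\<close>

definition wedge :: "'k::comm_ring_1 ^ 'n \<Rightarrow> 'k ^ 'n \<Rightarrow> 'k ^ 'n ^ 'n" where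
  "wedge v w = (\<chi> i j. v $ i * w $ j - w $ i * v $ j)"

lemma wedge_congruence:
  fixes J :: "'k::comm_ring_1 ^ 'n::finite ^ 'm"
  shows "J ** wedge v w ** transpose J = wedge (J *v v) (J *v w)"
proof -
  have "(\<Sum>l\<in>UNIV. (\<Sum>k\<in>UNIV. J $ i $ k * (v $ k * w $ l - w $ k * v $ l)) * J $ j $ l) =
      (\<Sum>k\<in>UNIV. J $ i $ k * v $ k) * (\<Sum>l\<in>UNIV. J $ j $ l * w $ l) -
      (\<Sum>k\<in>UNIV. J $ i $ k * w $ k) * (\<Sum>l\<in>UNIV. J $ j $ l * v $ l)" for i j
  proof -
    have "(\<Sum>l\<in>UNIV. (\<Sum>k\<in>UNIV. J $ i $ k * (v $ k * w $ l - w $ k * v $ l)) * J $ j $ l) =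
        (\<Sum>l\<in>UNIV. (\<Sum>k\<in>UNIV. J $ i $ k * v $ k) * (J $ j $ l * w $ l) -
          (\<Sum>k\<in>UNIV. J $ i $ k * w $ k) * (J $ j $ l * v $ l))"
      by (intro sum.cong refl)
         (simp add: sum_distrib_left sum_distrib_right sum_subtractf[symmetric] algebra_simps)
    then show ?thesis by (simp add: sum_subtractf sum_distrib_left)
  qed
  then show ?thesis
    by (simp add: vec_eq_iff wedge_def matrix_matrix_mult_def matrix_vector_mult_def transpose_def)
qed

lemma frechet_matrix_works:
  fixes F :: "'k::real_normed_field ^ 'n::finite \<Rightarrow> 'k ^ 'm::finite"
  assumes F: "(F has_derivative D) (at x)" and D: "\<And>c v. D (c *s v) = c *s D v"
  shows "matrix (frechet_derivative F (at x)) *v v = D v"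
proof -
  interpret D: bounded_linear D by (rule has_derivative_bounded_linear[OF F])
  have "Vector_Spaces.linear (*s) (*s) D"
    unfolding Vector_Spaces.linear_iff by (intro conjI allI vec.vector_space_axioms D.add D)
  then show ?thesis
    using matrix_works[of D v] frechet_derivative_at[OF F] by simp
qed

text \<open>Decomposable bi-vectors are pushed forward factor by factor, so later computations only involve
  the derivative of the coordinates on single vectors.\<close>

lemma bivector_in_coordinates_wedge:
  fixes F :: "'k::ground_field ^ 3 \<Rightarrow> 'k ^ 3"
  assumes F: "(F has_derivative D) (at x)" and D: "\<And>c v. D (c *s v) = c *s D v"
    and P: "P x = wedge v w"
  shows "bivector_in_coordinates F P x = wedge (D v) (D w)"
  by (simp add: bivector_in_coordinates_def P wedge_congruence frechet_matrix_works[OF F D])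

text \<open>Chosen for the pair of planar fields \<open>x\<^sub>1\<partial>\<^sub>1 + x\<^sub>2\<partial>\<^sub>2\<close> and \<open>\<partial>\<^sub>1\<close>: the first kills \<open>x\<^sub>1 / x\<^sub>2\<close> and the second
  kills \<open>1 / x\<^sub>2\<close>, while their values on the other of these functions are \<open>- 1 / x\<^sub>2\<close> and \<open>1 / x\<^sub>2\<close>. The third
  coordinate \<open>x\<^sub>2 x\<^sub>3\<close> contributes the factor \<open>x\<^sub>2\<close> that turns these brackets into constants. The map
  is an involution, so that the inverse chart needs no separate treatment.\<close>

definition homogeneous_chart :: "'k::field ^ 3 \<Rightarrow> 'k ^ 3" where
  "homogeneous_chart x = vector [x $ 1 / x $ 2, 1 / x $ 2, x $ 2 * x $ 3]"

lemma homogeneous_chart_nth: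
  "homogeneous_chart x $ 1 = x $ 1 / x $ 2" "homogeneous_chart x $ 2 = 1 / x $ 2"
  "homogeneous_chart x $ 3 = x $ 2 * x $ 3"
  by (simp_all add: homogeneous_chart_def vector_3)

lemma homogeneous_chart_involution:
  "x $ 2 \<noteq> 0 \<Longrightarrow> homogeneous_chart (homogeneous_chart x) = x"
  by (simp add: vec_eq_iff forall_3 homogeneous_chart_nth)

lemma homogeneous_chart_has_derivative:
  fixes x :: "'k::real_normed_field ^ 3"
  assumes "x $ 2 \<noteq> 0"
  shows "(homogeneous_chart has_derivative (\<lambda>v. vector [v $ 1 / x $ 2 - x $ 1 * v $ 2 / (x $ 2)\<^sup>2,
    - v $ 2 / (x $ 2)\<^sup>2, x $ 3 * v $ 2 + x $ 2 * v $ 3])) (at x)"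
proof (rule has_derivative_vec)
  fix i :: 3
  have nth: "((\<lambda>x :: 'k ^ 3. x $ j) has_derivative (\<lambda>v. v $ j)) (at x)" for j
    by (rule bounded_linear_imp_has_derivative) (rule bounded_linear_vec_nth)
  have inv: "((\<lambda>x. 1 / x $ 2) has_derivative (\<lambda>v. - v $ 2 / (x $ 2)\<^sup>2)) (at x)"
    using Deriv.has_derivative_inverse[OF assms nth[of 2]]
    by (simp add: inverse_eq_divide power2_eq_square mult.commute)
  moreover have "((\<lambda>x. x $ 1 / x $ 2) has_derivative (\<lambda>v. v $ 1 / x $ 2 - x $ 1 * v $ 2 / (x $ 2)\<^sup>2)) (at x)"
    using has_derivative_mult[OF nth[of 1] inv] by (simp add: algebra_simps)
  moreover have "((\<lambda>x. x $ 2 * x $ 3) has_derivative (\<lambda>v. x $ 3 * v $ 2 + x $ 2 * v $ 3)) (at x)"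
    using has_derivative_mult[OF nth[of 2] nth[of 3]] by (simp add: algebra_simps)
  ultimately show "((\<lambda>x. homogeneous_chart x $ i) has_derivative
      (\<lambda>v. vector [v $ 1 / x $ 2 - x $ 1 * v $ 2 / (x $ 2)\<^sup>2,
        - v $ 2 / (x $ 2)\<^sup>2, x $ 3 * v $ 2 + x $ 2 * v $ 3] $ i)) (at x)"
    using exhaust_3[of i] by (auto simp: homogeneous_chart_nth vector_3)
qed

lemma (in coordinate_field) local_coordinates_homogeneous_chart:
  "local_coordinates {x :: 'k ^ 3. x $ 2 \<noteq> 0} homogeneous_chart"
proof -
  let ?U = "{x :: 'k ^ 3. x $ 2 \<noteq> 0}"
  have op: "open ?U"
    by (intro open_Collect_neq continuous_on_const continuous_on_component continuous_on_id)
  have image: "homogeneous_chart ` ?U = ?U"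
  proof
    show "homogeneous_chart ` ?U \<subseteq> ?U" by (auto simp: homogeneous_chart_nth)
    show "?U \<subseteq> homogeneous_chart ` ?U"
    proof
      fix x :: "'k ^ 3" assume "x \<in> ?U"
      then show "x \<in> homogeneous_chart ` ?U"
        by (intro image_eqI[of _ _ "homogeneous_chart x"])
           (auto simp: homogeneous_chart_involution homogeneous_chart_nth)
    qed
  qed
  have inj: "inj_on homogeneous_chart ?U"
    by (rule inj_on_inverseI[of _ homogeneous_chart]) (simp add: homogeneous_chart_involution)
  have inverse: "inv_into ?U homogeneous_chart x = homogeneous_chart x" if "x \<in> ?U" for x
    using that by (intro inv_into_f_eq inj) (auto simp: homogeneous_chart_involution homogeneous_chart_nth)
  have "rational_on ?U (\<lambda>x. x $ 1 * inverse (x $ 2))" "rational_on ?U (\<lambda>x. inverse (x $ 2))"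
    "rational_on ?U (\<lambda>x. x $ 2 * x $ 3)"
    by (intro rational_on.intros; simp)+
  then have rational: "rational_on ?U (\<lambda>x. homogeneous_chart x $ i)" for i
    using exhaust_3[of i] by (auto simp: homogeneous_chart_nth field_simps)
  show ?thesis
    unfolding local_coordinates_def image
    by (intro conjI op inj rational_regular_on[OF op rational] refl inverse)
qed

section \<open>Flatness in the scalar case\<close>

context linear_poisson_pair
begin

lemma beta_add_left: "\<beta> (a + b) c = \<beta> a c + \<beta> b c"
  and beta_scale_left: "\<beta> (scale k a) c = k * \<beta> a c"
  and beta_diff_left: "\<beta> (a - b) c = \<beta> a c - \<beta> b c"
proof -
  interpret l: Vector_Spaces.linear scale "(*)" "\<lambda>a. \<beta> a c" by (rule linear_left)
  show "\<beta> (a + b) c = \<beta> a c + \<beta> b c" "\<beta> (scale k a) c = k * \<beta> a c"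
    "\<beta> (a - b) c = \<beta> a c - \<beta> b c"
    by (rule l.add l.scale l.diff)+
qed

lemma beta_add_right: "\<beta> c (a + b) = \<beta> c a + \<beta> c b"
  and beta_scale_right: "\<beta> c (scale k a) = k * \<beta> c a"
  and beta_diff_right: "\<beta> c (a - b) = \<beta> c a - \<beta> c b"
proof -
  interpret l: Vector_Spaces.linear scale "(*)" "\<beta> c" by (rule linear_right)
  show "\<beta> c (a + b) = \<beta> c a + \<beta> c b" "\<beta> c (scale k a) = k * \<beta> c a"
    "\<beta> c (a - b) = \<beta> c a - \<beta> c b"
    by (rule l.add l.scale l.diff)+
qed

lemmas beta_linear = beta_add_left beta_add_right beta_scale_left beta_scale_right
  beta_diff_left beta_diff_right

lemma beta_antisym: "\<beta> a b = - \<beta> b a"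
proof -
  have "\<beta> (a + b) (a + b) = 0" by (rule alternating)
  then show ?thesis
    using alternating[of a] alternating[of b]
    by (simp only: beta_add_left beta_add_right eq_neg_iff_add_eq_0) (simp add: add.commute)
qed

lemma frame_iff: "frame e \<longleftrightarrow> coordinate_frame scale e"
  unfolding frame_def coordinate_frame_def coordinate_frame_axioms_def
  using vector_space_axioms by blast

lemma linear_dual_point:
  assumes "coordinate_frame scale e"
  shows "Vector_Spaces.linear scale (*) (dual_point e x)"
proof -
  interpret e: coordinate_frame scale e by fact
  have eq: "dual_point e x = (\<lambda>a. \<Sum>i\<in>UNIV. e.coord i a * x $ i)"
    by (simp add: fun_eq_iff dual_point_def e.coord_def)
  show ?thesis
    unfolding Vector_Spaces.linear_iff eq
    by (intro conjI allI vector_space_axioms vector_space_over_itself.vector_space_axioms)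
       (simp_all add: e.coord_add e.coord_scale distrib_right sum.distrib sum_distrib_left mult.assoc)
qed

lemma dual_point_frame:
  assumes "coordinate_frame scale e"
  shows "dual_point e x (e i) = x $ i"
proof -
  interpret e: coordinate_frame scale e by fact
  have "e.coord j (e i) * x $ j = (if j = i then x $ i else 0)" for j
    by (cases "j = i") (simp_all only: e.coord_frame if_True if_False simp_thms mult_1 mult_zero_left)
  then have "dual_point e x (e i) = (\<Sum>j\<in>UNIV. if j = i then x $ i else 0)"
    by (simp only: dual_point_def e.coord_def)
  then show ?thesis by simp
qed

lemma dual_point_of_functional:
  assumes "coordinate_frame scale e" and p: "Vector_Spaces.linear scale (*) p"
  shows "dual_point e (\<chi> i. p (e i)) = p"
proof -
  interpret e: coordinate_frame scale e by fact
  show ?thesis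
  proof
    fix a
    have "dual_point e (\<chi> i. p (e i)) a = (\<Sum>i\<in>UNIV. e.coord i a * p (e i))"
      by (simp add: dual_point_def e.coord_def)
    then show "dual_point e (\<chi> i. p (e i)) a = p a"
      by (simp only: e.linear_functional_expand[OF p, of a])
  qed
qed

end

locale nonunimodular_poisson = nonunimodular_lie_algebra scale bracket u +
  coordinate_field "TYPE('k)"
  for scale :: "'k::ground_field \<Rightarrow> 'a::ab_group_add \<Rightarrow> 'a" and bracket u
begin

text \<open>By the formula for the bracket the Lie--Poisson structure is at each point a wedge
  product with one and the same constant vector, formed by the heights of the frame. A cocycle that
  vanishes on the ideal has this factor too; only the second factors differ, a linear vector field and a
  constant one.\<close>

lemma coefficients_lie_poisson:
  assumes "linear_poisson_pair scale bracket \<beta>" and e: "coordinate_frame scale e"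
  shows "linear_poisson_pair.coefficients scale e (linear_poisson_pair.lie_poisson bracket) x =
    wedge (\<chi> i. height (e i)) (\<chi> i. linear_poisson_pair.dual_point scale e x (bracket u (e i)))"
proof -
  interpret pair: linear_poisson_pair scale bracket \<beta> by fact
  interpret p: Vector_Spaces.linear scale "(*)" "pair.dual_point e x"
    by (rule pair.linear_dual_point[OF e])
  have eq: "pair.dual_point e x (bracket a b) =
      height a * pair.dual_point e x (bracket u b) - height b * pair.dual_point e x (bracket u a)" for a b
    by (subst bracket_eq) (simp add: p.diff p.scale)
  have "pair.coefficients e pair.lie_poisson x $ i $ j = wedge (\<chi> i. height (e i))
      (\<chi> i. pair.dual_point e x (bracket u (e i))) $ i $ j" for i j
    using eq[of "e i" "e j"] by (simp add: wedge_def pair.coefficients_def pair.lie_poisson_def mult.commute)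
  then show ?thesis by (simp only: vec_eq_iff) simp
qed

lemma coefficients_constant_bivector:
  assumes "linear_poisson_pair scale bracket \<beta>"
    and \<beta>: "\<And>a b. \<beta> a b = height a * \<phi> b - height b * \<phi> a"
  shows "linear_poisson_pair.coefficients scale e (linear_poisson_pair.constant_bivector \<beta>) x =
    wedge (\<chi> i. height (e i)) (\<chi> i. \<phi> (e i))"
proof -
  interpret pair: linear_poisson_pair scale bracket \<beta> by fact
  show ?thesis
    by (simp add: vec_eq_iff wedge_def pair.coefficients_def pair.constant_bivector_def \<beta> mult.commute)
qed

text \<open>On the ideal the cocycle condition with \<open>u\<close> as third argument reads \<open>2 c \<beta>(a, b) = 0\<close>, and \<open>2 c\<close> is the
  trace of the adjoint map of \<open>u\<close>, hence non-zero. So the cocycle vanishes on the ideal, which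
  makes it a wedge product with the height.\<close>

lemma cocycle_decomposition_if_scalar:
  assumes "linear_poisson_pair scale bracket \<beta>"
    and scalar: "\<And>a. a \<in> unimodular_ideal \<Longrightarrow> bracket u a = scale c a"
  shows "\<beta> a b = height a * \<beta> u b - height b * \<beta> u a"
proof -
  interpret pair: linear_poisson_pair scale bracket \<beta> by fact
  obtain g1 g2 where g: "g1 \<in> unimodular_ideal" "g2 \<in> unimodular_ideal" "g2 \<noteq> 0"
    "\<And>k. g1 \<noteq> scale k g2" using ideal_independent_pair by metis
  have frame: "coordinate_frame scale (($) (vector [g1, g2, u] :: 'a ^ 3))"
    by (rule adapted_frame) (use g in auto)
  interpret g: coordinate_frame scale "($) (vector [g1, g2, u] :: 'a ^ 3)" by fact
  have "ad_trace u = c + c"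
    using ad_trace_adapted[OF g(1,2) frame, of u] g.coord_frame[of 1 1] g.coord_frame[of 2 2]
    by (simp add: scalar g(1,2) g.coord_scale vector_3)
  then have c: "c + c \<noteq> 0" using ad_trace_u by simp
  have ideal: "\<beta> a b = 0" if a: "a \<in> unimodular_ideal" and b: "b \<in> unimodular_ideal" for a b
  proof -
    have "\<beta> (bracket a b) u + \<beta> (bracket b u) a + \<beta> (bracket u a) b = 0"
      by (rule pair.cocycle)
    moreover have "\<beta> (bracket a b) u = 0"
      using pair.beta_scale_left[of 0 0 u] by (simp add: ideal_abelian a b)
    moreover have "\<beta> (bracket b u) a = c * \<beta> a b"
    proof -
      have "bracket b u = scale (- c) b"
        using bracket_antisym[of b u] scalar[OF b] by (simp add: scale_minus_left)
      then show ?thesis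
        using pair.beta_antisym[of b a] by (simp add: pair.beta_scale_left del: scale_minus_left)
    qed
    ultimately have "(c + c) * \<beta> a b = 0"
      by (simp add: scalar a pair.beta_scale_left distrib_right)
    with c show ?thesis by simp
  qed
  have "\<beta> (a - scale (height a) u) (b - scale (height b) u) = 0"
    by (intro ideal ideal_part_in_ideal)
  then show ?thesis
    using pair.beta_antisym[of a u] by (simp add: pair.beta_linear pair.alternating algebra_simps)
qed

text \<open>In the scalar case any basis of the ideal can be used. It is adapted to the cocycle, \<open>\<beta>(u, f1) = 1\<close>
  and \<open>\<beta>(u, f2) = 0\<close>, so that in the resulting coordinates the planar parts of the pair are \<open>c\<close> times
  the Euler field and \<open>\<partial>\<^sub>1\<close>. Generic points have \<open>x\<^sub>2 \<noteq> 0\<close>, where the chart above flattens both.\<close>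

lemma flat_if_scalar:
  assumes "linear_poisson_pair scale bracket \<beta>"
    and scalar: "\<And>a. a \<in> unimodular_ideal \<Longrightarrow> bracket u a = scale c a"
  shows "linear_poisson_pair.flat scale bracket \<beta>"
proof -
  interpret pair: linear_poisson_pair scale bracket \<beta> by fact
  note \<beta>_eq = cocycle_decomposition_if_scalar[OF assms]
  show ?thesis
    unfolding pair.flat_def
  proof (intro ballI impI)
    fix p assume p: "p \<in> pair.dual" and generic: "pair.generic_at p"
    interpret p: Vector_Spaces.linear scale "(*)" p using p by (simp add: pair.dual_def)
    have \<beta>_nonzero: "\<exists>a\<in>unimodular_ideal. \<beta> u a \<noteq> 0"
    proof (rule ccontr)
      assume "\<not> ?thesis"
      then have zero: "\<beta> u b = 0" for b
        using ideal_part_in_ideal[of b]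
        by (metis pair.beta_diff_right pair.beta_scale_right pair.alternating mult_zero_right diff_zero)
      have "\<beta> a b = 0" for a b by (simp only: \<beta>_eq[of a b] zero) simp
      with generic[unfolded pair.generic_at_def, rule_format, of 0 1] show False
        by (simp add: pair.constant_bivector_def to_complex_zero)
    qed
    obtain f1 f2 where f: "f1 \<in> unimodular_ideal" "f2 \<in> unimodular_ideal" "f2 \<noteq> 0"
      and \<beta>f: "\<beta> u f1 = 1" "\<beta> u f2 = 0"
    proof -
      obtain a where a: "a \<in> unimodular_ideal" "\<beta> u a \<noteq> 0" using \<beta>_nonzero by blast
      define f1 where "f1 = scale (inverse (\<beta> u a)) a"
      have f1: "f1 \<in> unimodular_ideal" "\<beta> u f1 = 1"
        using a subspace_scale[OF subspace_ideal] by (simp_all add: f1_def pair.beta_scale_right)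
      obtain g1 g2 where g: "g1 \<in> unimodular_ideal" "g2 \<in> unimodular_ideal" "g2 \<noteq> 0"
        "\<And>k. g1 \<noteq> scale k g2" using ideal_independent_pair by metis
      \<comment> \<open>The projection along \<open>f1\<close> onto the kernel of \<open>\<beta> u\<close> cannot kill two independent vectors.\<close>
      define proj where "proj b = b - scale (\<beta> u b) f1" for b
      have proj: "proj b \<in> unimodular_ideal" "\<beta> u (proj b) = 0" if "b \<in> unimodular_ideal" for b
        using that f1 subspace_diff[OF subspace_ideal] subspace_scale[OF subspace_ideal]
        by (simp_all add: proj_def pair.beta_diff_right pair.beta_scale_right)
      have "proj g1 \<noteq> 0 \<or> proj g2 \<noteq> 0"
      proof (rule ccontr)
        assume "\<not> ?thesis"
        then have eq: "g1 = scale (\<beta> u g1) f1" "g2 = scale (\<beta> u g2) f1"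
          by (simp_all add: proj_def)
        with g(3) have "\<beta> u g2 \<noteq> 0" by auto
        with eq have "g1 = scale (\<beta> u g1 / \<beta> u g2) g2"
          by (metis scale_scale nonzero_eq_divide_eq)
        with g(4) show False by blast
      qed
      with proj g f1 that show thesis by blast
    qed
    have f_indep: "f1 \<noteq> scale k f2" for k
      using \<beta>f by (auto simp: pair.beta_scale_right)
    define e where "e = ($) (vector [f1, f2, u] :: 'a ^ 3)"
    have e_nth: "e 1 = f1" "e 2 = f2" "e 3 = u" by (simp_all add: e_def vector_3)
    have frame: "coordinate_frame scale e"
      unfolding e_def by (rule adapted_frame[OF f f_indep])
    interpret e: coordinate_frame scale e by fact
    have p_bracket: "p (bracket a b) = c * p f1 * \<beta> a b" if "p f2 = 0" for a b
    proof -
      have on_u: "p (bracket u b) = c * p f1 * \<beta> u b" for b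
      proof -
        have b: "scale (e.coord 1 b) f1 + scale (e.coord 2 b) f2 + scale (height b) u = b"
          using adapted_coord(2)[OF f(1,2)] frame by (simp add: e_def)
        have "p (bracket u b) = c * (e.coord 1 b * p f1)"
          by (subst b[symmetric])
             (simp add: bracket_linear scalar f bracket_self p.add p.scale that)
        moreover have "\<beta> u b = e.coord 1 b"
          by (subst b[symmetric]) (simp add: pair.beta_linear \<beta>f pair.alternating)
        ultimately show ?thesis by simp
      qed
      have "p (bracket a b) = height a * p (bracket u b) - height b * p (bracket u a)"
        by (simp only: bracket_eq[of a b] p.diff p.scale)
      also have "\<dots> = c * p f1 * (height a * \<beta> u b - height b * \<beta> u a)"
        by (simp only: on_u) (simp add: algebra_simps)
      finally show ?thesis by (simp only: \<beta>_eq[of a b])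
    qed
    \<comment> \<open>Otherwise the two bi-vectors are proportional at \<open>p\<close>, with factor \<open>c * p f1\<close>.\<close>
    have p_f2: "p f2 \<noteq> 0"
    proof
      assume "p f2 = 0"
      then have "1 * to_complex (p (bracket a b)) + - to_complex (c * p f1) * to_complex (\<beta> a b) = 0"
        for a b by (simp add: p_bracket to_complex_mult)
      then show False
        using generic unfolding pair.generic_at_def pair.lie_poisson_def pair.constant_bivector_def
        by (metis prod.inject zero_neq_one)
    qed
    define U where "U = {x :: 'k ^ 3. x $ 2 \<noteq> 0}"
    define C C\<^sub>1 :: "'k ^ 3 ^ 3" where
      "C = wedge (vector [0, 0, 1]) (vector [0, - c, 0])" and
      "C\<^sub>1 = wedge (vector [0, 0, 1]) (vector [1, 0, 0])"
    have heights: "(\<chi> i. height (e i)) = vector [0, 0, 1]"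
      using f by (simp add: vec_eq_iff forall_3 vector_3 e_nth height_u ideal_iff_height)
    have flat: "bivector_in_coordinates homogeneous_chart (pair.coefficients e pair.lie_poisson) x = C"
      "bivector_in_coordinates homogeneous_chart (pair.coefficients e pair.constant_bivector) x = C\<^sub>1"
      if "x \<in> U" for x
    proof -
      have x: "x $ 2 \<noteq> 0" using that by (simp add: U_def)
      define D where "D v = (vector [v $ 1 / x $ 2 - x $ 1 * v $ 2 / (x $ 2)\<^sup>2,
        - v $ 2 / (x $ 2)\<^sup>2, x $ 3 * v $ 2 + x $ 2 * v $ 3] :: 'k ^ 3)" for v :: "'k ^ 3"
      have D: "(homogeneous_chart has_derivative D) (at x)"
        unfolding D_def by (rule homogeneous_chart_has_derivative[OF x])
      have D_scale: "D (k *s v) = k *s D v" for k v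
        by (simp add: D_def vec_eq_iff forall_3 vector_3 algebra_simps)
      interpret q: Vector_Spaces.linear scale "(*)" "pair.dual_point e x"
        by (rule pair.linear_dual_point[OF frame])
      have "(\<chi> i. pair.dual_point e x (bracket u (e i))) = vector [c * x $ 1, c * x $ 2, 0]"
        using pair.dual_point_frame[OF frame, of x 1] pair.dual_point_frame[OF frame, of x 2]
        by (simp add: vec_eq_iff forall_3 vector_3 e_nth scalar f q.scale bracket_self q.zero)
      then have "bivector_in_coordinates homogeneous_chart (pair.coefficients e pair.lie_poisson) x =
          wedge (D (vector [0, 0, 1])) (D (vector [c * x $ 1, c * x $ 2, 0]))"
        by (intro bivector_in_coordinates_wedge D D_scale)
           (simp add: coefficients_lie_poisson[OF assms(1) frame] heights)
      also have "\<dots> = C"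
        using x by (simp add: D_def C_def vec_eq_iff forall_3 wedge_def vector_3 power2_eq_square)
      finally show "bivector_in_coordinates homogeneous_chart (pair.coefficients e pair.lie_poisson) x = C" .
      have "(\<chi> i. \<beta> u (e i)) = vector [1, 0, 0]"
        by (simp add: vec_eq_iff forall_3 vector_3 e_nth \<beta>f pair.alternating)
      then have "bivector_in_coordinates homogeneous_chart (pair.coefficients e pair.constant_bivector) x =
          wedge (D (vector [0, 0, 1])) (D (vector [1, 0, 0]))"
        by (intro bivector_in_coordinates_wedge D D_scale)
           (simp add: coefficients_constant_bivector[OF assms(1) \<beta>_eq] heights)
      also have "\<dots> = C\<^sub>1"
        using x by (simp add: D_def C\<^sub>1_def vec_eq_iff forall_3 wedge_def vector_3 power2_eq_square)
      finally show "bivector_in_coordinates homogeneous_chart (pair.coefficients e pair.constant_bivector) x = C\<^sub>1" .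
    qed
    have "(\<chi> i. p (e i)) \<in> U" using p_f2 by (simp add: U_def e_nth)
    moreover have "local_coordinates U homogeneous_chart"
      unfolding U_def by (rule local_coordinates_homogeneous_chart)
    ultimately show "pair.flat_at p"
      unfolding pair.flat_at_def pair.frame_iff using flat frame by blast
  qed
qed

end

section \<open>Rigidity of planar webs\<close>

text \<open>Here \<open>g0\<close> and \<open>g1\<close> are first integrals of the planar fields \<open>X = (a (q + s) + b r) \<partial>\<^sub>s + (q + s) \<partial>\<^sub>r\<close> and
  \<open>Y = \<partial>\<^sub>s\<close>, scaled by a common factor \<open>h\<close> so that \<open>g0 + t g1\<close> is a first integral of \<open>X + t Y\<close> for all \<open>t\<close>.
  Equality of the mixed derivatives of \<open>g0\<close> would say \<open>a h + (q + s) h' = 0\<close> for a function \<open>h\<close> of \<open>r\<close>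
  alone, and varying \<open>s\<close> gives \<open>h' = 0\<close>, then \<open>h = 0\<close>. To get by with a single derivative, the equation is
  integrated once along \<open>s\<close>: the difference \<open>g0 0 r - g0 s r\<close> equals \<open>K s * h 0 r\<close> with a known quadratic
  \<open>K\<close>, and its \<open>r\<close>-derivatives for two values of \<open>s\<close> contradict each other unless \<open>h\<close> vanishes.\<close>

lemma planar_web_rigid:
  fixes g0 g1 h :: "'k::real_normed_field \<Rightarrow> 'k \<Rightarrow> 'k"
  assumes "0 < \<epsilon>" and "a \<noteq> 0"
    and d1s: "\<And>s r. norm s < \<epsilon> \<Longrightarrow> norm r < \<epsilon> \<Longrightarrow> ((\<lambda>s. g1 s r) has_field_derivative 0) (at s)"
    and d1r: "\<And>s r. norm s < \<epsilon> \<Longrightarrow> norm r < \<epsilon> \<Longrightarrow> ((\<lambda>r. g1 s r) has_field_derivative h s r) (at r)"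
    and d0s: "\<And>s r. norm s < \<epsilon> \<Longrightarrow> norm r < \<epsilon> \<Longrightarrow>
      ((\<lambda>s. g0 s r) has_field_derivative - ((q + s) * h s r)) (at s)"
    and d0r: "\<And>s r. norm s < \<epsilon> \<Longrightarrow> norm r < \<epsilon> \<Longrightarrow>
      ((\<lambda>r. g0 s r) has_field_derivative (a * (q + s) + b * r) * h s r) (at r)"
  shows "h 0 0 = 0"
proof -
  have is_constant: "f s = f 0" if "\<And>s. norm s < \<epsilon> \<Longrightarrow> (f has_field_derivative 0) (at s)" "norm s < \<epsilon>"
    for f :: "'k \<Rightarrow> 'k" and s
  proof -
    have "\<exists>c. \<forall>x\<in>ball 0 \<epsilon>. f x = c"
      by (rule has_field_derivative_zero_constant)
         (auto intro: has_field_derivative_at_within that(1))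
    then show ?thesis using that(2) \<open>0 < \<epsilon>\<close> by auto
  qed
  have h_eq: "h s r = h 0 r" if s: "norm s < \<epsilon>" and r: "norm r < \<epsilon>" for s r
  proof (rule DERIV_unique)
    show "((\<lambda>r. g1 s r) has_field_derivative h s r) (at r)" by (rule d1r[OF s r])
    show "((\<lambda>r. g1 s r) has_field_derivative h 0 r) (at r)"
    proof (rule has_field_derivative_transform_within_open[of "\<lambda>r. g1 0 r"])
      show "((\<lambda>r. g1 0 r) has_field_derivative h 0 r) (at r)" using r \<open>0 < \<epsilon>\<close> by (intro d1r) auto
      show "g1 0 x = g1 s x" if "x \<in> ball 0 \<epsilon>" for x
        using is_constant[of "\<lambda>s. g1 s x" s] d1s that s by simp
    qed (use r in auto)
  qed
  define K where "K s = q * s + s\<^sup>2 / 2" for s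
  have K_h: "K s * h 0 r = g0 0 r - g0 s r" if s: "norm s < \<epsilon>" and r: "norm r < \<epsilon>" for s r
  proof -
    have "((\<lambda>s. g0 s r + K s * h 0 r) has_field_derivative 0) (at s)" if "norm s < \<epsilon>" for s
      unfolding K_def
      by (rule derivative_eq_intros d0s that r refl | simp)+
         (simp add: h_eq[OF that r] algebra_simps)
    from is_constant[OF this s] show ?thesis by (simp add: K_def algebra_simps)
  qed
  have derivative: "((\<lambda>r. K s * h 0 r) has_field_derivative - (a * s * h 0 0)) (at 0)"
    if s: "norm s < \<epsilon>" for s
  proof (rule has_field_derivative_transform_within_open[of "\<lambda>r. g0 0 r - g0 s r"])
    have "((\<lambda>r. g0 0 r - g0 s r) has_field_derivative
        (a * (q + 0) + b * 0) * h 0 0 - (a * (q + s) + b * 0) * h s 0) (at 0)"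
      using \<open>0 < \<epsilon>\<close> s by (intro DERIV_diff d0r) auto
    then show "((\<lambda>r. g0 0 r - g0 s r) has_field_derivative - (a * s * h 0 0)) (at 0)"
      using h_eq[OF s, of 0] \<open>0 < \<epsilon>\<close> by (simp add: algebra_simps)
    show "g0 0 r - g0 s r = K s * h 0 r" if "r \<in> ball 0 \<epsilon>" for r
      using K_h[OF s, of r] that by simp
  qed (use \<open>0 < \<epsilon>\<close> in auto)
  define t :: 'k where "t = of_real (\<epsilon> / 4)"
  have t: "t \<noteq> 0" "norm t < \<epsilon>" "norm (2 * t) < \<epsilon>"
    using \<open>0 < \<epsilon>\<close> by (simp_all add: t_def norm_mult)
  \<comment> \<open>Cross-multiplying with \<open>K\<close> compares the derivatives for \<open>s = t\<close> and \<open>s = 2 t\<close> without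
    assuming that \<open>h 0\<close> itself is differentiable.\<close>
  have "K (2 * t) * - (a * t * h 0 0) = K t * - (a * (2 * t) * h 0 0)"
  proof (rule DERIV_unique)
    show "((\<lambda>r. K (2 * t) * (K t * h 0 r)) has_field_derivative K (2 * t) * - (a * t * h 0 0)) (at 0)"
      by (intro DERIV_cmult derivative t)
    show "((\<lambda>r. K (2 * t) * (K t * h 0 r)) has_field_derivative K t * - (a * (2 * t) * h 0 0)) (at 0)"
      using DERIV_cmult[OF derivative[OF t(3)], of "K t"] by (simp add: mult.left_commute)
  qed
  then have "a * t ^ 3 * h 0 0 = 0"
    by (simp add: K_def power2_eq_square power3_eq_cube field_simps)
  with \<open>a \<noteq> 0\<close> t(1) show ?thesis by simp
qed


section \<open>A non-flat pair in the non-scalar case\<close>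

lemma has_field_derivative_along_line:
  fixes F :: "'k::real_normed_field ^ 'n::finite \<Rightarrow> 'k ^ 'm::finite"
  assumes F: "(F has_derivative D) (at (p + t *s v))"
    and scale: "\<And>c. D (c *s v) = c *s D v"
  shows "((\<lambda>t. \<Sum>i\<in>UNIV. k $ i * F (p + t *s v) $ i) has_field_derivative
    (\<Sum>i\<in>UNIV. k $ i * D v $ i)) (at t)"
proof -
  have "((\<lambda>t. p + t *s v) has_derivative (\<lambda>c. c *s v)) (at t)"
    by (rule has_derivative_vec) (auto intro!: derivative_eq_intros)
  from has_derivative_compose[OF this F]
  have "((\<lambda>t. F (p + t *s v)) has_derivative (\<lambda>c. c *s D v)) (at t)"
    by (simp add: scale)
  then have nth: "((\<lambda>t. F (p + t *s v) $ i) has_derivative (\<lambda>c. c * D v $ i)) (at t)" for i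
    using bounded_linear.has_derivative[OF bounded_linear_vec_nth] by fastforce
  have "((\<lambda>t. \<Sum>i\<in>UNIV. k $ i * F (p + t *s v) $ i) has_derivative
      (\<lambda>c. \<Sum>i\<in>UNIV. k $ i * (c * D v $ i))) (at t)"
    by (intro has_derivative_sum has_derivative_mult_right nth)
  moreover have "(\<lambda>c. \<Sum>i\<in>UNIV. k $ i * (c * D v $ i)) = (*) (\<Sum>i\<in>UNIV. k $ i * D v $ i)"
    by (simp add: fun_eq_iff sum_distrib_left mult_ac)
  ultimately show ?thesis by (simp add: has_field_derivative_def)
qed

text \<open>The pairing with the axial vector of an antisymmetric matrix. The axial vector of \<open>v \<and> w\<close> is the cross
  product of \<open>v\<close> and \<open>w\<close>; it spans the kernel of a constant bi-vector, so that its pairing with the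
  coordinates is a Casimir function.\<close>

definition axial_pairing :: "'k::comm_ring_1 ^ 3 ^ 3 \<Rightarrow> 'k ^ 3 \<Rightarrow> 'k" where
  "axial_pairing C z = (\<Sum>i\<in>UNIV. vector [C $ 2 $ 3, C $ 3 $ 1, C $ 1 $ 2] $ i * z $ i)"

lemma axial_pairing_linear:
  "axial_pairing C (v + w) = axial_pairing C v + axial_pairing C w"
  "axial_pairing C (k *s v) = k * axial_pairing C v"
  by (simp_all add: axial_pairing_def sum_3 vector_3 algebra_simps)

text \<open>The identities are the usual ones for the triple product: it vanishes for equal
  arguments and changes sign when two are exchanged.\<close>

lemma axial_pairing_wedge:
  "axial_pairing (wedge v w) v = 0"
  "axial_pairing (wedge v w) w = 0"
  "axial_pairing (wedge v w) w' + axial_pairing (wedge v w') w = 0"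
  by (simp_all add: axial_pairing_def wedge_def sum_3 vector_3 algebra_simps)

lemma wedge_eq_0_if_axial_pairing_eq_0:
  fixes v w :: "'k::comm_ring_1 ^ 3"
  assumes "\<And>z. axial_pairing (wedge v w) z = 0"
  shows "wedge v w = 0"
proof -
  have "axial_pairing (wedge v w) (axis i 1) = vector [wedge v w $ 2 $ 3, wedge v w $ 3 $ 1, wedge v w $ 1 $ 2] $ i"
    for i :: 3
    by (simp add: axial_pairing_def axis_def if_distrib cong: if_cong)
  with assms have "wedge v w $ 2 $ 3 = 0" "wedge v w $ 3 $ 1 = 0" "wedge v w $ 1 $ 2 = 0"
    by (metis vector_3)+
  then show ?thesis
    by (auto simp: vec_eq_iff forall_3 wedge_def algebra_simps)
qed

lemma (in coordinate_field) local_coordinates_derivative: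
  fixes F :: "'k ^ 3 \<Rightarrow> 'k ^ 3"
  assumes chart: "local_coordinates U F" and x: "x \<in> U"
  obtains D E where "(F has_derivative D) (at x)" "\<And>c v. D (c *s v) = c *s D v"
    "(inv_into U F has_derivative E) (at (F x))" "\<And>c v. E (c *s v) = c *s E v"
    "\<And>v. D (E v) = v" "\<And>v. E (D v) = v"
proof -
  have op: "open U" "open (F ` U)" and inj: "inj_on F U"
    using chart by (simp_all add: local_coordinates_def)
  obtain D where D: "(F has_derivative D) (at x)" "\<And>c v. D (c *s v) = c *s D v"
    using chart x regular_on_differentiable unfolding local_coordinates_def by blast
  obtain E where E: "(inv_into U F has_derivative E) (at (F x))" "\<And>c v. E (c *s v) = c *s E v"
    using chart x regular_on_differentiable[of "F ` U" "inv_into U F" "F x"]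
    unfolding local_coordinates_def by blast
  have inv: "inv_into U F (F y) = y" if "y \<in> U" for y
    using inj that by (rule inv_into_f_f)
  have "((\<lambda>y. inv_into U F (F y)) has_derivative (\<lambda>v. E (D v))) (at x)"
    by (rule has_derivative_compose[OF D(1) E(1)])
  then have "((\<lambda>y. y) has_derivative (\<lambda>v. E (D v))) (at x)"
    by (rule has_derivative_transform_within_open[OF _ op(1) x]) (rule inv)
  then have ED: "(\<lambda>v. E (D v)) = (\<lambda>v. v)"
    by (rule has_derivative_unique) (rule has_derivative_ident)
  have "(F has_derivative D) (at (inv_into U F (F x)))"
    using D(1) by (simp add: inv x)
  then have "((\<lambda>y. F (inv_into U F y)) has_derivative (\<lambda>v. D (E v))) (at (F x))"
    by (rule has_derivative_compose[OF E(1)])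
  then have "((\<lambda>y. y) has_derivative (\<lambda>v. D (E v))) (at (F x))"
    by (rule has_derivative_transform_within_open[OF _ op(2) imageI[OF x]]) (rule f_inv_into_f)
  then have DE: "(\<lambda>v. D (E v)) = (\<lambda>v. v)"
    by (rule has_derivative_unique) (rule has_derivative_ident)
  show thesis
    by (rule that[OF D E fun_cong[OF DE] fun_cong[OF ED]])
qed

context nonunimodular_poisson
begin

text \<open>When \<open>f2\<close> is not an eigenvector, \<open>f2\<close> and its image \<open>f1\<close> form a basis of the ideal. In it the
  adjoint map of \<open>u\<close> sends \<open>f2\<close> to \<open>f1\<close>, so its trace is the \<open>f1\<close>-coordinate of \<open>[u, f1]\<close>.\<close>

context
  fixes f1 f2
  assumes f2: "f2 \<in> unimodular_ideal" and non_eigen: "\<And>k. bracket u f2 \<noteq> scale k f2"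
    and f1: "f1 = bracket u f2"
begin

interpretation f: coordinate_frame scale "($) (vector [f1, f2, u] :: 'a ^ 3)"
proof (rule adapted_frame)
  show "f1 \<in> unimodular_ideal" by (simp add: f1 ideal_iff_height height_bracket)
  show "f2 \<noteq> 0" using non_eigen[of 0] bracket_scale_right[of u 0 0] by auto
qed (use f2 non_eigen f1 in auto)

abbreviation "\<xi> \<equiv> f.coord"

lemma f1_in_ideal: "f1 \<in> unimodular_ideal"
  by (simp add: f1 ideal_iff_height height_bracket)

lemma coord_on_frame: "\<xi> 1 f1 = 1" "\<xi> 1 f2 = 0" "\<xi> 1 u = 0" "\<xi> 2 f1 = 0" "\<xi> 2 f2 = 1" "\<xi> 2 u = 0"
  using f.coord_frame[of 1 1] f.coord_frame[of 1 2] f.coord_frame[of 1 3]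
    f.coord_frame[of 2 1] f.coord_frame[of 2 2] f.coord_frame[of 2 3]
  by (simp_all add: vector_3)

lemma expand_adapted: "scale (\<xi> 1 a) f1 + scale (\<xi> 2 a) f2 + scale (height a) u = a"
  by (rule adapted_coord(2)[OF f1_in_ideal f2 f.coordinate_frame_axioms])

lemma bracket_u_adapted: "bracket u a = scale (\<xi> 1 a) (bracket u f1) + scale (\<xi> 2 a) f1"
proof -
  have "bracket u a = bracket u (scale (\<xi> 1 a) f1 + scale (\<xi> 2 a) f2 + scale (height a) u)"
    by (simp only: expand_adapted)
  then show ?thesis by (simp add: bracket_linear bracket_self f1)
qed

lemma ad_trace_u_eq: "ad_trace u = \<xi> 1 (bracket u f1)"
  using ad_trace_adapted[OF f1_in_ideal f2 f.coordinate_frame_axioms, of u] coord_on_frame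
  by (simp add: f1)

text \<open>The wedge product of the height with the first coordinate; inside the ideal, \<open>f2\<close> spans the kernel
  of its contraction with \<open>u\<close>. Flatness would require this kernel to be an eigenline, which \<open>f2\<close> violates.\<close>

definition nonflat_cocycle :: "'a \<Rightarrow> 'a \<Rightarrow> 'k" where
  "nonflat_cocycle a b = height a * \<xi> 1 b - height b * \<xi> 1 a"

lemma nonflat_cocycle_pair: "linear_poisson_pair scale bracket nonflat_cocycle"
proof (intro linear_poisson_pair.intro linear_poisson_pair_axioms.intro lie_algebra_axioms)
  show "Vector_Spaces.linear scale (*) (\<lambda>a. nonflat_cocycle a b)" "Vector_Spaces.linear scale (*) (nonflat_cocycle a)" for a b
    unfolding Vector_Spaces.linear_iff nonflat_cocycle_def
    by (intro conjI allI vector_space_axioms vector_space_over_itself.vector_space_axioms;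
        simp add: f.coord_add f.coord_scale height_add height_scale algebra_simps)+
  show "nonflat_cocycle a a = 0" for a by (simp add: nonflat_cocycle_def)
  show "nonflat_cocycle (bracket a b) c + nonflat_cocycle (bracket b c) a + nonflat_cocycle (bracket c a) b = 0" for a b c
  proof -
    have coord_bracket: "\<xi> 1 (bracket a b) = height a * \<xi> 1 (bracket u b) - height b * \<xi> 1 (bracket u a)" for a b
    proof -
      interpret c: Vector_Spaces.linear scale "(*)" "\<xi> 1" by (rule f.linear_coord)
      show ?thesis by (simp only: bracket_eq[of a b] c.diff c.scale)
    qed
    show ?thesis
      unfolding nonflat_cocycle_def height_bracket coord_bracket[of a b] coord_bracket[of b c] coord_bracket[of c a]
      by (simp add: algebra_simps)
  qed
qed

interpretation pair: linear_poisson_pair scale bracket nonflat_cocycle by (rule nonflat_cocycle_pair)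

lemma nonflat_cocycle_generic_at: "pair.generic_at (\<xi> 1)"
  unfolding pair.generic_at_def
proof (intro allI impI)
  fix s t :: complex assume st: "(s, t) \<noteq> (0, 0)"
  show "\<exists>a b. s * to_complex (pair.lie_poisson (\<xi> 1) a b) + t * to_complex (pair.constant_bivector (\<xi> 1) a b) \<noteq> 0"
  proof (cases "s = 0")
    case True
    then have "s * to_complex (pair.lie_poisson (\<xi> 1) u f1) + t * to_complex (pair.constant_bivector (\<xi> 1) u f1) \<noteq> 0"
      using st by (simp add: pair.constant_bivector_def nonflat_cocycle_def height_u coord_on_frame to_complex_one)
    then show ?thesis by blast
  next
    case False
    then have "s * to_complex (pair.lie_poisson (\<xi> 1) u f2) + t * to_complex (pair.constant_bivector (\<xi> 1) u f2) \<noteq> 0"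
      using f1 f2 by (simp add: pair.constant_bivector_def pair.lie_poisson_def nonflat_cocycle_def ideal_iff_height
          coord_on_frame to_complex_one to_complex_zero flip: f1)
    then show ?thesis by blast
  qed
qed

text \<open>Suppose that a chart \<open>F\<close> turns both bi-vectors into constants \<open>C\<close> and \<open>C\<^sub>1\<close>. The pairings \<open>g0\<close> and \<open>g1\<close> of \<open>F\<close>
  with the axial vectors of these constants are Casimir functions, and \<open>g0 + t g1\<close> is one for the whole
  pencil. Restricted to the plane spanned by the directions \<open>Y\<close> and \<open>Z\<close> dual to \<open>f1\<close> and \<open>f2\<close> they are the
  functions of the planar rigidity lemma. So the differential of \<open>g1\<close> vanishes at the base point. As \<open>F\<close> is
  a diffeomorphism, this forces \<open>C\<^sub>1 = 0\<close>, and the cocycle would be zero.\<close>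

lemma nonflat_cocycle_not_flat_at: "\<not> pair.flat_at (\<xi> 1)"
proof
  assume "pair.flat_at (\<xi> 1)"
  then obtain e U F C C\<^sub>1 where frame: "coordinate_frame scale e"
    and base_in_U: "(\<chi> i. \<xi> 1 (e i)) \<in> U" and chart: "local_coordinates U F"
    and flat0: "\<And>x. x \<in> U \<Longrightarrow> bivector_in_coordinates F (pair.coefficients e pair.lie_poisson) x = C"
    and flat1: "\<And>x. x \<in> U \<Longrightarrow> bivector_in_coordinates F (pair.coefficients e pair.constant_bivector) x = C\<^sub>1"
    unfolding pair.flat_at_def pair.frame_iff by blast
  interpret e: coordinate_frame scale e by (rule frame)
  define W Y Z :: "'k ^ 3" where
    "W = (\<chi> i. height (e i))" and "Y = (\<chi> i. \<xi> 1 (e i))" and "Z = (\<chi> i. \<xi> 2 (e i))"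
  define pt where "pt s r = (1 + s) *s Y + r *s Z" for s r
  define a where "a = \<xi> 1 (bracket u f1)"
  define b where "b = \<xi> 2 (bracket u f1)"
  have "a \<noteq> 0" using ad_trace_u by (simp add: a_def ad_trace_u_eq)
  obtain D where D: "\<And>x. x \<in> U \<Longrightarrow> (F has_derivative D x) (at x)"
    and D_scale: "\<And>x c v. x \<in> U \<Longrightarrow> D x (c *s v) = c *s D x v"
    using chart regular_on_differentiable[of U F] unfolding local_coordinates_def by metis
  have D_add: "D x (v + w) = D x v + D x w" if "x \<in> U" for x v w
    using linear_add[OF has_derivative_linear[OF D[OF that]]] .
  \<comment> \<open>At \<open>pt s r\<close> the base functional \<open>\<xi> 1\<close>, whose coordinate vector is \<open>Y\<close>, has been moved by \<open>s\<close> along \<open>Y\<close>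
    and by \<open>r\<close> along \<open>Z\<close>.\<close>
  have dual_pt: "pair.dual_point e (pt s r) = (\<lambda>d. (1 + s) * \<xi> 1 d + r * \<xi> 2 d)" for s r
  proof -
    have "Vector_Spaces.linear scale (*) (\<lambda>d. (1 + s) * \<xi> 1 d + r * \<xi> 2 d)"
      unfolding Vector_Spaces.linear_iff
      by (intro conjI allI vector_space_axioms vector_space_over_itself.vector_space_axioms;
          simp add: f.coord_add f.coord_scale algebra_simps)
    from pair.dual_point_of_functional[OF frame this] show ?thesis
      by (simp add: pt_def Y_def Z_def plus_vec_def vector_scalar_mult_def)
  qed
  have "pair.coefficients e pair.lie_poisson (pt s r) =
      wedge W (((1 + s) * a + r * b) *s Y + (1 + s) *s Z)" for s r
  proof -
    have "\<xi> 1 (bracket u d) = \<xi> 1 d * a + \<xi> 2 d" "\<xi> 2 (bracket u d) = \<xi> 1 d * b" for d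
      using bracket_u_adapted[of d] by (simp_all only: f.coord_add f.coord_scale coord_on_frame a_def b_def) simp_all
    then show ?thesis
      unfolding coefficients_lie_poisson[OF nonflat_cocycle_pair frame] dual_pt
      by (intro arg_cong2[of _ _ _ _ wedge]) (simp_all add: W_def Y_def Z_def vec_eq_iff algebra_simps)
  qed
  then have C: "wedge (D (pt s r) W) (D (pt s r) (((1 + s) * a + r * b) *s Y + (1 + s) *s Z)) = C"
    if "pt s r \<in> U" for s r
    using bivector_in_coordinates_wedge[OF D[OF that] D_scale[OF that]] flat0[OF that] by metis
  have "pair.coefficients e pair.constant_bivector x = wedge W Y" for x
    unfolding W_def Y_def by (rule coefficients_constant_bivector[OF nonflat_cocycle_pair]) (simp add: nonflat_cocycle_def)
  then have C1: "wedge (D x W) (D x Y) = C\<^sub>1" if "x \<in> U" for x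
    using bivector_in_coordinates_wedge[OF D[OF that] D_scale[OF that]] flat1[OF that] by metis
  define g0 g1 h where "g0 s r = axial_pairing C (F (pt s r))"
    and "g1 s r = axial_pairing C\<^sub>1 (F (pt s r))" and "h s r = axial_pairing C\<^sub>1 (D (pt s r) Z)" for s r
  \<comment> \<open>The three components of the Casimir condition for the pencil: \<open>g1\<close> is constant along \<open>Y\<close>, the mixed
    condition gives the derivative of \<open>g0\<close> along \<open>Y\<close>, and constancy of \<open>g0\<close> along the linear field
    \<open>((1 + s) a + r b) Y + (1 + s) Z\<close> gives the one along \<open>Z\<close>.\<close>
  have casimir:
    "axial_pairing C\<^sub>1 (D (pt s r) Y) = 0"
    "axial_pairing C (D (pt s r) Y) = - ((1 + s) * h s r)"
    "axial_pairing C (D (pt s r) Z) = (a * (1 + s) + b * r) * h s r"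
    if U: "pt s r \<in> U" and s: "1 + s \<noteq> 0" for s r
  proof -
    let ?W = "D (pt s r) W" and ?Y = "D (pt s r) Y" and ?Z = "D (pt s r) Z"
    let ?X = "((1 + s) * a + r * b) *s ?Y + (1 + s) *s ?Z"
    have C': "C = wedge ?W ?X" using C[OF U] by (simp add: D_add[OF U] D_scale[OF U])
    show Y: "axial_pairing C\<^sub>1 ?Y = 0"
      using C1[OF U] axial_pairing_wedge(2) by metis
    have "axial_pairing C\<^sub>1 ?X + axial_pairing C ?Y = 0"
      using C1[OF U] C' axial_pairing_wedge(3) by metis
    with Y have "axial_pairing C ?Y + (1 + s) * h s r = 0"
      by (simp add: axial_pairing_linear h_def distrib_right add.commute)
    then show CY: "axial_pairing C ?Y = - ((1 + s) * h s r)"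
      by (simp only: eq_neg_iff_add_eq_0)
    have "axial_pairing C ?X = 0"
      using C' axial_pairing_wedge(2) by metis
    then have "(1 + s) * axial_pairing C ?Z = (1 + s) * ((a * (1 + s) + b * r) * h s r)"
      by (simp add: axial_pairing_linear CY algebra_simps)
    with s show "axial_pairing C ?Z = (a * (1 + s) + b * r) * h s r" by simp
  qed
  \<comment> \<open>Besides staying in the chart, \<open>\<epsilon> \<le> 1\<close> keeps \<open>1 + s\<close>, the \<open>Z\<close>-component of the linear field, non-zero.\<close>
  obtain \<epsilon> where "0 < \<epsilon>" and \<epsilon>: "\<And>s r. norm s < \<epsilon> \<Longrightarrow> norm r < \<epsilon> \<Longrightarrow> pt s r \<in> U \<and> 1 + s \<noteq> 0"
  proof -
    have "continuous_on UNIV (\<lambda>z :: 'k \<times> 'k. \<chi> i. (1 + fst z) * Y $ i + snd z * Z $ i)"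
      by (intro continuous_intros)
    moreover have "(\<lambda>z. \<chi> i. (1 + fst z) * Y $ i + snd z * Z $ i) = (\<lambda>z. pt (fst z) (snd z))"
      by (simp add: fun_eq_iff vec_eq_iff pt_def distrib_right)
    ultimately have "continuous_on UNIV (\<lambda>z. pt (fst z) (snd z))" by (simp only:)
    then have "open ((\<lambda>z. pt (fst z) (snd z)) -` U)"
      using chart by (intro open_vimage) (simp_all add: local_coordinates_def)
    moreover have "(0, 0) \<in> (\<lambda>z. pt (fst z) (snd z)) -` U"
      using base_in_U by (simp add: pt_def Y_def)
    ultimately obtain \<delta> where "0 < \<delta>" and \<delta>: "ball (0, 0) \<delta> \<subseteq> (\<lambda>z. pt (fst z) (snd z)) -` U"
      using open_contains_ball by blast
    have "pt s r \<in> U \<and> 1 + s \<noteq> 0" if "norm s < min (\<delta> / 2) 1" "norm r < min (\<delta> / 2) 1" for s r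
    proof
      have "norm (- s, - r) \<le> norm s + norm r" using norm_Pair_le[of "- s" "- r"] by simp
      then have "(s, r) \<in> ball (0, 0) \<delta>" using that by (simp add: dist_norm)
      with \<delta> show "pt s r \<in> U" by auto
      show "1 + s \<noteq> 0"
      proof
        assume "1 + s = 0"
        then have "s = - 1" by (simp add: add_eq_0_iff)
        with that(1) show False by simp
      qed
    qed
    with \<open>0 < \<delta>\<close> that[of "min (\<delta> / 2) 1"] show thesis by simp
  qed
  have derivative:
    "((\<lambda>s. axial_pairing K (F (pt s r))) has_field_derivative axial_pairing K (D (pt s r) Y)) (at s)"
    "((\<lambda>r. axial_pairing K (F (pt s r))) has_field_derivative axial_pairing K (D (pt s r) Z)) (at r)"
    if U: "pt s r \<in> U" for K s r
  proof -
    have s_line: "pt t r = (Y + r *s Z) + t *s Y" and r_line: "pt s t = (1 + s) *s Y + t *s Z" for t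
      by (simp_all add: pt_def vec_eq_iff algebra_simps)
    define D\<^sub>0 where "D\<^sub>0 = D (pt s r)"
    have D0: "(F has_derivative D\<^sub>0) (at (pt s r))" "\<And>c v. D\<^sub>0 (c *s v) = c *s D\<^sub>0 v"
      using D[OF U] D_scale[OF U] by (simp_all add: D\<^sub>0_def)
    have "((\<lambda>s. axial_pairing K (F (Y + r *s Z + s *s Y))) has_field_derivative axial_pairing K (D\<^sub>0 Y)) (at s)"
      unfolding axial_pairing_def
      by (rule has_field_derivative_along_line[where D = D\<^sub>0, OF D0(1)[unfolded s_line] D0(2)])
    then show "((\<lambda>s. axial_pairing K (F (pt s r))) has_field_derivative axial_pairing K (D (pt s r) Y)) (at s)"
      by (simp only: s_line D\<^sub>0_def)
    have "((\<lambda>r. axial_pairing K (F ((1 + s) *s Y + r *s Z))) has_field_derivative axial_pairing K (D\<^sub>0 Z)) (at r)"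
      unfolding axial_pairing_def
      by (rule has_field_derivative_along_line[where D = D\<^sub>0, OF D0(1)[unfolded r_line] D0(2)])
    then show "((\<lambda>r. axial_pairing K (F (pt s r))) has_field_derivative axial_pairing K (D (pt s r) Z)) (at r)"
      by (simp only: r_line D\<^sub>0_def)
  qed
  have "h 0 0 = 0"
  proof (rule planar_web_rigid[OF \<open>0 < \<epsilon>\<close> \<open>a \<noteq> 0\<close>, of g1 h g0 1 b])
    fix s r :: 'k assume "norm s < \<epsilon>" "norm r < \<epsilon>"
    with \<epsilon> have U: "pt s r \<in> U" and s: "1 + s \<noteq> 0" by blast+
    show "((\<lambda>s. g1 s r) has_field_derivative 0) (at s)"
      using derivative(1)[OF U, of "C\<^sub>1"] by (simp add: g1_def casimir(1)[OF U s])
    show "((\<lambda>r. g1 s r) has_field_derivative h s r) (at r)"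
      using derivative(2)[OF U, of "C\<^sub>1"] by (simp add: g1_def h_def)
    show "((\<lambda>s. g0 s r) has_field_derivative - ((1 + s) * h s r)) (at s)"
      using derivative(1)[OF U, of C] by (simp add: g0_def casimir(2)[OF U s])
    show "((\<lambda>r. g0 s r) has_field_derivative (a * (1 + s) + b * r) * h s r) (at r)"
      using derivative(2)[OF U, of C] by (simp add: g0_def casimir(3)[OF U s])
  qed
  have pt_0: "pt 0 0 = Y" by (simp add: pt_def vec_eq_iff)
  have U: "Y \<in> U" using base_in_U by (simp add: Y_def)
  obtain D' E where D': "(F has_derivative D') (at Y)" and D'_scale: "\<And>c v. D' (c *s v) = c *s D' v"
    and E: "(inv_into U F has_derivative E) (at (F Y))" "\<And>c v. E (c *s v) = c *s E v"
    and DE: "\<And>v. D' (E v) = v" and ED: "\<And>v. E (D' v) = v"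
    using local_coordinates_derivative[OF chart U] by blast
  have D'_eq: "D' = D Y" using has_derivative_unique[OF D' D[OF U]] .
  have C1_Y: "C\<^sub>1 = wedge (D' W) (D' Y)" using C1[OF U] by (simp add: D'_eq)
  have zero: "axial_pairing C\<^sub>1 (D' W) = 0" "axial_pairing C\<^sub>1 (D' Y) = 0" "axial_pairing C\<^sub>1 (D' Z) = 0"
    using \<open>h 0 0 = 0\<close> by (simp_all add: C1_Y axial_pairing_wedge h_def pt_0 flip: D'_eq)
  \<comment> \<open>The vectors \<open>Y\<close>, \<open>Z\<close>, \<open>W\<close> are the coordinates of the basis dual to \<open>f1\<close>, \<open>f2\<close>, \<open>u\<close> and span the
    coordinate space.\<close>
  have "axial_pairing C\<^sub>1 (D' v) = 0" for v
  proof -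
    interpret q: Vector_Spaces.linear scale "(*)" "pair.dual_point e v"
      by (rule pair.linear_dual_point[OF frame])
    let ?q = "pair.dual_point e v"
    have expand: "?q d = \<xi> 1 d * ?q f1 + \<xi> 2 d * ?q f2 + height d * ?q u" for d
      using arg_cong[OF expand_adapted[of d], of ?q] by (simp only: q.add q.scale)
    have "v $ i = (?q f1 *s Y + ?q f2 *s Z + ?q u *s W) $ i" for i
    proof -
      have "v $ i = ?q (e i)" by (rule pair.dual_point_frame[OF frame, symmetric])
      also have "\<dots> = \<xi> 1 (e i) * ?q f1 + \<xi> 2 (e i) * ?q f2 + height (e i) * ?q u"
        by (rule expand)
      finally show ?thesis by (simp add: Y_def Z_def W_def mult.commute)
    qed
    then have "v = ?q f1 *s Y + ?q f2 *s Z + ?q u *s W" by (simp only: vec_eq_iff) simp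
    then have "D' v = ?q f1 *s D' Y + ?q f2 *s D' Z + ?q u *s D' W"
      using D_add[OF U] D'_scale by (metis D'_eq)
    then show ?thesis by (simp add: axial_pairing_linear zero)
  qed
  then have "axial_pairing C\<^sub>1 v = 0" for v using DE by metis
  then have "wedge (D' W) (D' Y) = 0"
    using wedge_eq_0_if_axial_pairing_eq_0 C1_Y by metis
  then have "bivector_in_coordinates (inv_into U F) (\<lambda>_. 0) (F Y) = wedge (E (D' W)) (E (D' Y))"
    by (intro bivector_in_coordinates_wedge[OF E]) simp
  then have "wedge W Y = 0"
    by (simp add: ED bivector_in_coordinates_def)
  then have zero: "nonflat_cocycle (e i) (e j) = 0" for i j
    by (simp add: vec_eq_iff wedge_def W_def Y_def nonflat_cocycle_def mult.commute)
  have "nonflat_cocycle (e i) f1 = (\<Sum>j\<in>UNIV. e.coord j f1 * nonflat_cocycle (e i) (e j))" for i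
    by (rule e.linear_functional_expand[OF pair.linear_right])
  then have "nonflat_cocycle (e i) f1 = 0" for i by (simp only: zero) simp
  moreover have "nonflat_cocycle u f1 = (\<Sum>i\<in>UNIV. e.coord i u * nonflat_cocycle (e i) f1)"
    by (rule e.linear_functional_expand[OF pair.linear_left])
  ultimately have "nonflat_cocycle u f1 = 0" by simp
  then show False by (simp add: nonflat_cocycle_def coord_on_frame height_u)
qed

lemma nonflat_cocycle_generic_and_not_flat: "pair.generic" "\<not> pair.flat"
proof -
  have "\<xi> 1 \<in> pair.dual" by (simp add: pair.dual_def f.linear_coord)
  then show "pair.generic" "\<not> pair.flat"
    using nonflat_cocycle_generic_at nonflat_cocycle_not_flat_at unfolding pair.generic_def pair.flat_def by blast+
qed

end

theorem nonflat_pair_iff_not_scalar: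
  "(\<exists>\<beta>. linear_poisson_pair scale bracket \<beta> \<and> linear_poisson_pair.generic scale bracket \<beta> \<and>
      \<not> linear_poisson_pair.flat scale bracket \<beta>) \<longleftrightarrow>
    \<not> (\<exists>c. \<forall>a\<in>unimodular_ideal. bracket u a = scale c a)"
proof
  assume "\<not> (\<exists>c. \<forall>a\<in>unimodular_ideal. bracket u a = scale c a)"
  then obtain f2 where f2: "f2 \<in> unimodular_ideal" "\<And>k. bracket u f2 \<noteq> scale k f2"
    using nonscalar_vector by blast
  show "\<exists>\<beta>. linear_poisson_pair scale bracket \<beta> \<and> linear_poisson_pair.generic scale bracket \<beta> \<and>
      \<not> linear_poisson_pair.flat scale bracket \<beta>"
    using nonflat_cocycle_pair[OF f2 refl] nonflat_cocycle_generic_and_not_flat[OF f2 refl] by blast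
qed (use flat_if_scalar in blast)

end

theorem proposition8:
  "(\<forall>(scale :: real \<Rightarrow> 'a::ab_group_add \<Rightarrow> 'a) bracket u.
      lie_algebra scale bracket \<longrightarrow>
      vector_space.dim scale (UNIV :: 'a set) = 3 \<longrightarrow>
      \<not> lie_algebra.unimodular scale bracket \<longrightarrow>
      u \<notin> lie_algebra.unimodular_ideal scale bracket \<longrightarrow>
      ((\<exists>\<beta>. linear_poisson_pair scale bracket \<beta> \<and>
            linear_poisson_pair.generic scale bracket \<beta> \<and>
            \<not> linear_poisson_pair.flat scale bracket \<beta>) \<longleftrightarrow>
       \<not> (\<exists>c. \<forall>a\<in>lie_algebra.unimodular_ideal scale bracket. bracket u a = scale c a))) \<and>
   (\<forall>(scale :: complex \<Rightarrow> 'b::ab_group_add \<Rightarrow> 'b) bracket u.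
      lie_algebra scale bracket \<longrightarrow>
      vector_space.dim scale (UNIV :: 'b set) = 3 \<longrightarrow>
      \<not> lie_algebra.unimodular scale bracket \<longrightarrow>
      u \<notin> lie_algebra.unimodular_ideal scale bracket \<longrightarrow>
      ((\<exists>\<beta>. linear_poisson_pair scale bracket \<beta> \<and>
            linear_poisson_pair.generic scale bracket \<beta> \<and>
            \<not> linear_poisson_pair.flat scale bracket \<beta>) \<longleftrightarrow>
       \<not> (\<exists>c. \<forall>a\<in>lie_algebra.unimodular_ideal scale bracket. bracket u a = scale c a)))"
proof (intro conjI allI impI)
  fix scale :: "real \<Rightarrow> 'a \<Rightarrow> 'a" and bracket u
  assume "lie_algebra scale bracket" "vector_space.dim scale (UNIV :: 'a set) = 3"
    "u \<notin> lie_algebra.unimodular_ideal scale bracket"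
  then have "nonunimodular_poisson scale bracket u"
    by (intro nonunimodular_poisson.intro nonunimodular_lie_algebra.intro
        nonunimodular_lie_algebra_axioms.intro real.coordinate_field_axioms)
  then show "(\<exists>\<beta>. linear_poisson_pair scale bracket \<beta> \<and> linear_poisson_pair.generic scale bracket \<beta> \<and>
      \<not> linear_poisson_pair.flat scale bracket \<beta>) \<longleftrightarrow>
    \<not> (\<exists>c. \<forall>a\<in>lie_algebra.unimodular_ideal scale bracket. bracket u a = scale c a)"
    by (rule nonunimodular_poisson.nonflat_pair_iff_not_scalar)
next
  fix scale :: "complex \<Rightarrow> 'b \<Rightarrow> 'b" and bracket u
  assume "lie_algebra scale bracket" "vector_space.dim scale (UNIV :: 'b set) = 3"
    "u \<notin> lie_algebra.unimodular_ideal scale bracket"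
  then have "nonunimodular_poisson scale bracket u"
    by (intro nonunimodular_poisson.intro nonunimodular_lie_algebra.intro
        nonunimodular_lie_algebra_axioms.intro complex.coordinate_field_axioms)
  then show "(\<exists>\<beta>. linear_poisson_pair scale bracket \<beta> \<and> linear_poisson_pair.generic scale bracket \<beta> \<and>
      \<not> linear_poisson_pair.flat scale bracket \<beta>) \<longleftrightarrow>
    \<not> (\<exists>c. \<forall>a\<in>lie_algebra.unimodular_ideal scale bracket. bracket u a = scale c a)"
    by (rule nonunimodular_poisson.nonflat_pair_iff_not_scalar)
qed

end
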